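(* Let $\mathcal{P}$ be a 2.5 player parity game. Consider the following strategy improvement algorithm: start with an arbitrary pure memoryless Player $0$ strategy $f_0$; as long as $\mathcal{I}_{f_i}\cup\mathcal{I}'_{f_i}\neq\emptyset$, select an arbitrary $f_{i+1}\in\mathcal{I}_{f_i}\cup\mathcal{I}'_{f_i}$; stop when $\mathcal{I}_{f_i}=\mathcal{I}'_{f_i}=\emptyset$ and return $f_i$. This algorithm is correct: for every initial strategy and every sequence of selections it terminates after finitely many steps, and the returned strategy $f_i$ is an optimal Player $0$ strategy, i.e. $\mathrm{val}^{\mathcal{P}}_{f_i}(v)=\mathrm{val}^{\mathcal{P}}(v)$ for all vertices $v$.
   Context: A 2.5 player parity game is a tuple $\mathcal{P}=(V_0,V_1,V_r,E,\mathrm{prob},\mathrm{pri})$, where $V_0,V_1,V_r$ are finite disjoint sets of vertices (owned by Player $0$, Player $1$, and Player random), $V=V_0\cup V_1\cup V_r$, $E\subseteq V\times V$ is such that every $v\in V$ has at least one successor, $E_\sigma=E\cap(V_\sigma\times V)$ for $\sigma\in\{0,1,r\}$, $\mathrm{prob}$ maps each $v\in V_r$ to a rational-valued probability distribution on $V$ with $\mathrm{prob}(v)(v')>0$ iff $(v,v')\in E$, and $\mathrm{pri}:V\to\mathbb{N}$ is the priority function. A play is an infinite path; Player $0$ wins it iff the minimal priority occurring infinitely often on it is even. A strategy of Player $\sigma\in\{0,1\}$ is always pure and memoryless: a map $f_\sigma:V_\sigma\to V$ with $(v,f_\sigma(v))\in E$ for all $v \in V_\sigma$; $\mathrm{Strats}_\sigma$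 is the set of these. Fixing $f_0,f_1$ yields a Markov chain, and $\mathrm{val}^{\mathcal{P}}_{f_0,f_1}(v)$ is the probability that a play from $v$ is won by Player $0$. Further, $\mathrm{val}^{\mathcal{P}}_{f_0}(v)=\inf_{f_1\in \mathrm{Strats}_1}\mathrm{val}^{\mathcal{P}}_{f_0,f_1}(v)$ and $\mathrm{val}^{\mathcal{P}}(v)=\sup_{f_0\in \mathrm{Strats}_0}\inf_{f_1\in \mathrm{Strats}_1}\mathrm{val}^{\mathcal{P}}_{f_0,f_1}(v)$. A Player $0$ strategy $f$ is $v$-winning on $\mathcal{P}$ if $\mathrm{val}^{\mathcal{P}}_f(v)=1$. The winning region of Player $0$ on a game is the set of vertices $v$ for which she has a $v$-winning strategy on it. Profitable switches: $\mathrm{profit}(\mathcal{P},f)=\{(v,v')\in E_0 \mid \mathrm{val}^{\mathcal{P}}_f(v')>\mathrm{val}^{\mathcal{P}}_f(v)\}$. $\mathcal{I}_f=\{f'\in\mathrm{Strats}_0\mid f'\neq f$ and for all $v\in V_0$: $f'(v)=f(v)$ or $(v,f'(v))\in\mathrm{profit}(\mathcal{P},f)\}$. Neutral edges: $\mathrm{neutral}(\mathcal{P},f)=E_r\cup\{(v,v')\in E_0\cup E_1\mid \mathrm{val}^{\mathcal{P}}_f(v')=\mathrm{val}^{\mathcal{P}}_f(v)\}$. The neutral subgame is $\mathcal{P}'=\mathcal{P}\cap\mathrm{neutral}(\mathcal{P},f)$, i.e. $\mathcal{P}$ with edge set restricted to the neutral edges. Additional improvements $\mathcal{I}'_f$: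 let $W_0=\{v\in V\mid \mathrm{val}^{\mathcal{P}}_f(v)=1\}$ be the winning region of Player $0$ in $\mathcal{P}_f$ (the game with Player $0$'s choices fixed to $f$), and let $W_0'$ be the winning region of Player $0$ on $\mathcal{P}'$. If $W_0=W_0'$, then $\mathcal{I}'_f=\emptyset$. Otherwise let $\mathcal{W}$ be the set of Player $0$ strategies on $\mathcal{P}'$ that are $v$-winning on $\mathcal{P}'$ for all $v\in W_0'$; then $\mathcal{I}'_f$ is the set of $f'\in\mathrm{Strats}_0$ such that (i) there is $f_w\in\mathcal{W}$ with $f'(v)=f_w(v)$ for all $v\in V_0\cap W_0'$, (ii) $f'(v)=f(v)$ for all $v\in V_0\setminus W_0'$, and (iii) $f'(v)=f(v)$ for all $v\in V_0\cap W_0$. *)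

theory Defs
  imports "HOL-Probability.Probability"
begin

section \<open>2.5 player parity games\<close>

record 'v game =
  V0 :: "'v set"
  V1 :: "'v set"
  Vr :: "'v set"
  edges :: "('v \<times> 'v) set"
  trans_prob :: "'v \<Rightarrow> 'v pmf"
  pri :: "'v \<Rightarrow> nat"

definition verts :: "'v game \<Rightarrow> 'v set" where
  "verts G = V0 G \<union> V1 G \<union> Vr G"

text \<open>
  Only the values of \<^term>\<open>trans_prob G\<close> on random vertices are relevant. As \<^term>\<open>edges G\<close> only
  relates vertices, the positivity condition confines these distributions to \<^term>\<open>verts G\<close>.
\<close>

definition parity_game :: "'v game \<Rightarrow> bool" where
  "parity_game G \<longleftrightarrow>
     finite (V0 G) \<and> finite (V1 G) \<and> finite (Vr G) \<and>
     V0 G \<inter> V1 G = {} \<and> V0 G \<inter> Vr G = {} \<and> V1 G \<inter> Vr G = {} \<and>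
     edges G \<subseteq> verts G \<times> verts G \<and>
     (\<forall>v\<in>verts G. \<exists>v'. (v, v') \<in> edges G) \<and>
     (\<forall>v\<in>Vr G. \<forall>v'. pmf (trans_prob G v) v' \<in> \<rat>) \<and>
     (\<forall>v\<in>Vr G. \<forall>v'. pmf (trans_prob G v) v' > 0 \<longleftrightarrow> (v, v') \<in> edges G)"

definition E0 :: "'v game \<Rightarrow> ('v \<times> 'v) set" where
  "E0 G = edges G \<inter> (V0 G \<times> verts G)"

definition E1 :: "'v game \<Rightarrow> ('v \<times> 'v) set" where
  "E1 G = edges G \<inter> (V1 G \<times> verts G)"

definition Er :: "'v game \<Rightarrow> ('v \<times> 'v) set" where
  "Er G = edges G \<inter> (Vr G \<times> verts G)"

text \<open>
  Strategies are functions that are \<^term>\<open>undefined\<close> outside the vertices of their player, so that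
  equality of strategies is equality on these vertices.
\<close>

definition strats0 :: "'v game \<Rightarrow> ('v \<Rightarrow> 'v) set" where
  "strats0 G = (\<Pi>\<^sub>E v\<in>V0 G. {v'. (v, v') \<in> edges G})"

definition strats1 :: "'v game \<Rightarrow> ('v \<Rightarrow> 'v) set" where
  "strats1 G = (\<Pi>\<^sub>E v\<in>V1 G. {v'. (v, v') \<in> edges G})"


section \<open>The Markov chain induced by a pair of strategies\<close>

definition chain :: "'v game \<Rightarrow> ('v \<Rightarrow> 'v) \<Rightarrow> ('v \<Rightarrow> 'v) \<Rightarrow> 'v \<Rightarrow> 'v pmf" where
  "chain G f0 f1 v =
     (if v \<in> V0 G then return_pmf (f0 v)
      else if v \<in> V1 G then return_pmf (f1 v)
      else trans_prob G v)"

text \<open>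
  The distribution of position \<open>n\<close> of a play from \<open>v\<close>, given its prefix \<open>\<omega>\<close> of length \<open>n\<close>.
\<close>

definition play_kernel ::
    "'v game \<Rightarrow> ('v \<Rightarrow> 'v) \<Rightarrow> ('v \<Rightarrow> 'v) \<Rightarrow> 'v \<Rightarrow> nat \<Rightarrow> (nat \<Rightarrow> 'v) \<Rightarrow> 'v measure" where
  "play_kernel G f0 f1 v n \<omega> =
     measure_pmf (case n of 0 \<Rightarrow> return_pmf v | Suc m \<Rightarrow> chain G f0 f1 (\<omega> m))"

text \<open>
  The probability measure on infinite vertex sequences given by the Ionescu-Tulcea theorem;
  its values on cylinder sets are computed in \<open>measure_plays_cylinder\<close> below.
\<close>

definition plays :: "'v game \<Rightarrow> ('v \<Rightarrow> 'v) \<Rightarrow> ('v \<Rightarrow> 'v) \<Rightarrow> 'v \<Rightarrow> (nat \<Rightarrow> 'v) measure" where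
  "plays G f0 f1 v =
     projective_family.lim UNIV
       (Ionescu_Tulcea.CI (play_kernel G f0 f1 v) (\<lambda>_. count_space UNIV))
       (\<lambda>_. count_space UNIV)"

lemma Ionescu_Tulcea_play_kernel:
  "Ionescu_Tulcea (play_kernel G f0 f1 v) (\<lambda>_. count_space UNIV)"
proof (rule Ionescu_Tulcea.intro)
  show "play_kernel G f0 f1 v i
      \<in> measurable (PiM {0..<i} (\<lambda>_. count_space UNIV)) (subprob_algebra (count_space UNIV))" for i
  proof (cases i)
    case 0
    then show ?thesis
      by (auto simp: play_kernel_def[abs_def] measure_pmf_in_subprob_algebra)
  next
    case (Suc m)
    have "(\<lambda>\<omega>. \<omega> m) \<in> measurable (PiM {0..<i} (\<lambda>_. count_space UNIV)) (count_space (UNIV :: 'a set))"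
      using Suc by (intro measurable_component_singleton) auto
    moreover have "(\<lambda>x. measure_pmf (chain G f0 f1 x))
        \<in> measurable (count_space UNIV) (subprob_algebra (count_space UNIV))"
      by (auto simp: measure_pmf_in_subprob_algebra)
    ultimately show ?thesis
      using Suc measurable_compose by (fastforce simp: play_kernel_def[abs_def])
  qed
  show "prob_space (play_kernel G f0 f1 v i x)" for i x
    by (simp add: play_kernel_def measure_pmf.prob_space_axioms)
qed

lemma
  shows sets_plays: "sets (plays G f0 f1 v) = sets (PiM UNIV (\<lambda>_. count_space UNIV))"
    and space_plays: "space (plays G f0 f1 v) = UNIV"
    and prob_space_plays: "prob_space (plays G f0 f1 v)"
    and measure_plays_cylinder:
      "measure (plays G f0 f1 v) {\<omega>. \<forall>i\<le>n. \<omega> i = x i} =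
         (if x 0 = v then \<Prod>i<n. pmf (chain G f0 f1 (x i)) (x (Suc i)) else 0)"
proof -
  let ?M = "\<lambda>_::nat. count_space (UNIV :: 'a set)"
  interpret Ionescu_Tulcea "play_kernel G f0 f1 v" ?M
    by (rule Ionescu_Tulcea_play_kernel)
  show sets: "sets (plays G f0 f1 v) = sets (PiM UNIV ?M)"
    by (simp add: plays_def)
  show space: "space (plays G f0 f1 v) = UNIV"
    by (simp add: plays_def space_PiM)
  have emb: "emeasure (plays G f0 f1 v) (prod_emb UNIV ?M {0..<m} X)
      = emeasure (C 0 m (\<lambda>_. undefined)) X"
    if X: "X \<in> sets (PiM {0..<m} ?M)" for m X
  proof -
    have "prod_emb {0..<m} ?M {0..<m} X = X"
      using sets.sets_into_space[OF X] by (intro prod_emb_id) (auto simp: space_PiM)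
    then show ?thesis
      unfolding plays_def using lim[OF _ X] emeasure_CI[OF _ X, of m] by simp
  qed
  show "prob_space (plays G f0 f1 v)"
  proof
    have "prod_emb UNIV ?M {0..<0} (space (PiM {0..<0} ?M)) = UNIV"
      by (auto simp: prod_emb_def space_PiM)
    moreover have "emeasure (C 0 0 (\<lambda>_. undefined)) (space (PiM {0..<0} ?M)) = 1"
      using prob_space.emeasure_space_1[OF prob_space_C[of "\<lambda>_. undefined" 0 0]]
      by (simp add: space_C space_PiM)
    ultimately show "emeasure (plays G f0 f1 v) (space (plays G f0 f1 v)) = 1"
      using emb[of "space (PiM {0..<0} ?M)" 0] by (simp add: space)
  qed
  let ?X = "\<lambda>m. {restrict x {0..<m}}"
  let ?p = "\<lambda>i. case i of 0 \<Rightarrow> pmf (return_pmf v) (x 0)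
      | Suc j \<Rightarrow> pmf (chain G f0 f1 (x j)) (x (Suc j))"
  have X: "?X m \<in> sets (PiM {0..<m} ?M)" for m
  proof -
    have "?X m = PiE {0..<m} (\<lambda>i. {x i})"
      by (subst PiE_singleton[of "restrict x {0..<m}" "{0..<m}", symmetric]) (auto intro!: PiE_cong)
    also have "\<dots> \<in> sets (PiM {0..<m} ?M)"
      by (intro sets_PiM_I_finite) auto
    finally show ?thesis .
  qed
  have "emeasure (C 0 m (\<lambda>_. undefined)) (?X m) = ennreal (\<Prod>i<m. ?p i)" for m
  proof (induction m)
    case 0
    then show ?case
      by (simp add: restrict_def space_PiM PiM_empty)
  next
    case (Suc m)
    have u: "(\<lambda>_. undefined) \<in> space (PiM {0..<0} ?M)"
      by (simp add: space_PiM)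
    have step: "emeasure (eP m \<omega>) (?X (Suc m)) = ennreal (?p m) * indicator (?X m) \<omega>"
      if \<omega>: "\<omega> \<in> space (PiM {0..<m} ?M)" for \<omega>
    proof -
      have ext: "\<omega> \<in> extensional {0..<m}"
        using \<omega> by (simp add: space_PiM PiE_iff)
      have "(\<lambda>y. fun_upd \<omega> m y) -` ?X (Suc m) = (if \<omega> = restrict x {0..<m} then {x m} else {})"
      proof -
        have "fun_upd \<omega> m y = restrict x {0..<Suc m} \<longleftrightarrow> y = x m \<and> \<omega> = restrict x {0..<m}" for y
        proof
          assume eq: "fun_upd \<omega> m y = restrict x {0..<Suc m}"
          have "y = x m"
            using fun_cong[OF eq, of m] by simp
          moreover have "\<omega> = restrict x {0..<m}"
          proof
            fix i
            show "\<omega> i = restrict x {0..<m} i"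
              using fun_cong[OF eq, of i] extensional_arb[OF ext, of i]
              by (cases "i < m"; cases "i = m") simp_all
          qed
          ultimately show "y = x m \<and> \<omega> = restrict x {0..<m}" ..
        next
          assume "y = x m \<and> \<omega> = restrict x {0..<m}"
          then show "fun_upd \<omega> m y = restrict x {0..<Suc m}"
            by (auto simp: restrict_def)
        qed
        then show ?thesis
          by (simp add: vimage_def set_eq_iff)
      qed
      then have "emeasure (eP m \<omega>) (?X (Suc m))
          = emeasure (play_kernel G f0 f1 v m \<omega>) (if \<omega> = restrict x {0..<m} then {x m} else {})"
        using emeasure_eP[OF \<omega> X[of "Suc m"]] by simp
      also have "\<dots> = ennreal (?p m) * indicator (?X m) \<omega>"
        by (cases m) (auto simp: play_kernel_def emeasure_pmf_single ennreal_indicator)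
      finally show ?thesis .
    qed
    have "emeasure (C 0 (Suc m) (\<lambda>_. undefined)) (?X (Suc m))
        = (\<integral>\<^sup>+\<omega>. emeasure (eP m \<omega>) (?X (Suc m)) \<partial>C 0 m (\<lambda>_. undefined))"
      unfolding C.simps
    proof (subst emeasure_bind[where N = "PiM {0..<Suc m} ?M"])
      show "space (C 0 m (\<lambda>_. undefined)) \<noteq> {}"
        by (rule prob_space.not_empty[OF prob_space_C[OF u]])
      show "eP (0 + m) \<in> measurable (C 0 m (\<lambda>_. undefined)) (subprob_algebra (PiM {0..<Suc m} ?M))"
        using measurable_eP[of m] sets_C[OF u, of m]
        by (simp cong: measurable_cong_sets del: measurable_eP)
    qed (use X in simp_all)
    also have "\<dots> = (\<integral>\<^sup>+\<omega>. ennreal (?p m) * indicator (?X m) \<omega> \<partial>C 0 m (\<lambda>_. undefined))"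
      using u by (intro nn_integral_cong step) (simp add: space_C)
    also have "\<dots> = ennreal (?p m) * emeasure (C 0 m (\<lambda>_. undefined)) (?X m)"
      by (rule nn_integral_cmult_indicator) (use X[of m] sets_C[OF u, of m] in simp)
    also have "\<dots> = ennreal (\<Prod>i<Suc m. ?p i)"
      unfolding Suc.IH
      by (subst ennreal_mult[symmetric]) (auto intro!: prod_nonneg simp: mult.commute split: nat.split)
    finally show ?case .
  qed
  from this[of "Suc n"] emb[OF X[of "Suc n"]]
  have "emeasure (plays G f0 f1 v) (prod_emb UNIV ?M {0..<Suc n} (?X (Suc n)))
      = ennreal (\<Prod>i<Suc n. ?p i)"
    by simp
  moreover have "prod_emb UNIV ?M {0..<Suc n} (?X (Suc n)) = {\<omega>. \<forall>i\<le>n. \<omega> i = x i}"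
    by (auto simp: prod_emb_def fun_eq_iff restrict_def less_Suc_eq_le split: if_splits)
  moreover have "0 \<le> (\<Prod>i<Suc n. ?p i)"
    by (rule prod_nonneg) (simp split: nat.split)
  ultimately have "measure (plays G f0 f1 v) {\<omega>. \<forall>i\<le>n. \<omega> i = x i} = (\<Prod>i<Suc n. ?p i)"
    by (simp only: measure_def enn2real_ennreal)
  then show "measure (plays G f0 f1 v) {\<omega>. \<forall>i\<le>n. \<omega> i = x i} =
      (if x 0 = v then \<Prod>i<n. pmf (chain G f0 f1 (x i)) (x (Suc i)) else 0)"
    by (auto simp: prod.lessThan_Suc_shift pmf_return simp del: prod.lessThan_Suc)
qed

text \<open>
  A play stays in the finite set of vertices, so some priority occurs infinitely often and the least
  one exists.
\<close>

definition won_by_player0 :: "'v game \<Rightarrow> (nat \<Rightarrow> 'v) \<Rightarrow> bool" where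
  "won_by_player0 G \<omega> \<longleftrightarrow> even (LEAST p. \<exists>\<^sub>\<infinity>i. pri G (\<omega> i) = p)"

lemma sets_won_by_player0:
  "{\<omega>. won_by_player0 G \<omega>} \<in> sets (plays G f0 f1 v)"
proof -
  let ?N = "PiM UNIV (\<lambda>_. count_space UNIV) :: (nat \<Rightarrow> 'a) measure"
  have [measurable]: "(\<lambda>\<omega>. pri G (\<omega> i)) \<in> measurable ?N (count_space UNIV)" for i
    by (rule measurable_compose[OF measurable_component_singleton]) auto
  have "(\<lambda>\<omega>. LEAST p. \<exists>\<^sub>\<infinity>i. pri G (\<omega> i) = p) \<in> measurable ?N (count_space UNIV)"
    unfolding INFM_nat by measurable
  then have "{\<omega> \<in> space ?N. won_by_player0 G \<omega>} \<in> sets ?N"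
    unfolding won_by_player0_def by measurable
  then show ?thesis
    by (simp add: sets_plays space_PiM)
qed


section \<open>Values and winning regions\<close>

definition val_pair :: "'v game \<Rightarrow> ('v \<Rightarrow> 'v) \<Rightarrow> ('v \<Rightarrow> 'v) \<Rightarrow> 'v \<Rightarrow> real" where
  "val_pair G f0 f1 v = measure (plays G f0 f1 v) {\<omega>. won_by_player0 G \<omega>}"

definition val_strat :: "'v game \<Rightarrow> ('v \<Rightarrow> 'v) \<Rightarrow> 'v \<Rightarrow> real" where
  "val_strat G f0 v = (INF f1\<in>strats1 G. val_pair G f0 f1 v)"

definition val :: "'v game \<Rightarrow> 'v \<Rightarrow> real" where
  "val G v = (SUP f0\<in>strats0 G. INF f1\<in>strats1 G. val_pair G f0 f1 v)"

definition winning_strat :: "'v game \<Rightarrow> 'v \<Rightarrow> ('v \<Rightarrow> 'v) \<Rightarrow> bool" where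
  "winning_strat G v f \<longleftrightarrow> f \<in> strats0 G \<and> val_strat G f v = 1"

definition winning_region :: "'v game \<Rightarrow> 'v set" where
  "winning_region G = {v \<in> verts G. \<exists>f. winning_strat G v f}"


section \<open>Strategy improvement\<close>

definition profit :: "'v game \<Rightarrow> ('v \<Rightarrow> 'v) \<Rightarrow> ('v \<times> 'v) set" where
  "profit G f = {(v, v') \<in> E0 G. val_strat G f v' > val_strat G f v}"

definition improvements :: "'v game \<Rightarrow> ('v \<Rightarrow> 'v) \<Rightarrow> ('v \<Rightarrow> 'v) set" where
  "improvements G f =
     {f' \<in> strats0 G. f' \<noteq> f \<and> (\<forall>v\<in>V0 G. f' v = f v \<or> (v, f' v) \<in> profit G f)}"

definition neutral :: "'v game \<Rightarrow> ('v \<Rightarrow> 'v) \<Rightarrow> ('v \<times> 'v) set" where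
  "neutral G f = Er G \<union> {(v, v') \<in> E0 G \<union> E1 G. val_strat G f v' = val_strat G f v}"

definition neutral_subgame :: "'v game \<Rightarrow> ('v \<Rightarrow> 'v) \<Rightarrow> 'v game" where
  "neutral_subgame G f = G\<lparr>edges := edges G \<inter> neutral G f\<rparr>"

definition additional_improvements :: "'v game \<Rightarrow> ('v \<Rightarrow> 'v) \<Rightarrow> ('v \<Rightarrow> 'v) set" where
  "additional_improvements G f =
     (let G' = neutral_subgame G f;
          W0 = {v \<in> verts G. val_strat G f v = 1};
          W0' = winning_region G';
          W = {fw \<in> strats0 G'. \<forall>v\<in>W0'. winning_strat G' v fw}
      in if W0 = W0' then {}
         else {f' \<in> strats0 G.
                 (\<exists>fw\<in>W. \<forall>v\<in>V0 G \<inter> W0'. f' v = fw v) \<and>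
                 (\<forall>v\<in>V0 G - W0'. f' v = f v) \<and>
                 (\<forall>v\<in>V0 G \<inter> W0. f' v = f v)})"

end

theory Submission
  imports Defs
begin

text \<open>
  Everything rests on one maximum principle. Let $w$ be subharmonic and $u$ superharmonic for a finite
  Markov chain. If $w > u$ somewhere, then the maximisers of $w - u$ form a closed set, and so do the
  maximisers of $w$ among them; on this smaller closed set $C$ both functions are constant. A strict
  switch or a non-neutral edge cannot occur inside $C$, so there the chain coincides with one whose
  value is already known, which gives a contradiction. This shows that the better of two strategies,
  chosen vertex by vertex, is at least as good as both, hence that uniform best responses exist, and
  that both kinds of improvement increase the value. The sum of the values over all vertices then
  increases strictly in each step.

  If no improvement is left, let $w$ be the value of the current strategy $f$ and suppose that a strategy
  $g$ does better against a best response to its neutral part in the neutral subgame. On $C$ the winning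
  probability is constant and exceeds the constant $w$, so by the zero-one law it is $1$; but all edges
  in $C$ are neutral, so $C$ lies in the winning region of the neutral subgame, where $w = 1$.
\<close>


section \<open>Cylinders\<close>

abbreviation cyl :: "nat \<Rightarrow> (nat \<Rightarrow> 'v) \<Rightarrow> (nat \<Rightarrow> 'v) set" where
  "cyl n x \<equiv> {\<omega>. \<forall>i\<le>n. \<omega> i = x i}"

abbreviation seqs :: "(nat \<Rightarrow> 'v) measure" where
  "seqs \<equiv> PiM UNIV (\<lambda>_. count_space UNIV)"

lemma coordinate_in_sets: "{\<omega>. \<omega> i \<in> A} \<in> sets seqs"
  using measurable_sets[OF measurable_component_singleton[of i UNIV "\<lambda>_. count_space UNIV"], of A]
  by (simp add: space_PiM vimage_def)

lemma UNIV_in_sets: "UNIV \<in> sets seqs"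
  using sets.top[of seqs] by (simp add: space_PiM)

lemma box_in_sets:
  assumes "finite J"
  shows "{\<omega>. \<forall>i\<in>J. \<omega> i \<in> A i} \<in> sets seqs"
proof (cases "J = {}")
  case True
  then show ?thesis
    using sets.top[of seqs] by (simp add: space_PiM)
next
  case False
  then have "(\<Inter>i\<in>J. {\<omega>. \<omega> i \<in> A i}) \<in> sets seqs"
    using assms by (intro sets.finite_INT coordinate_in_sets)
  moreover have "(\<Inter>i\<in>J. {\<omega>. \<omega> i \<in> A i}) = {\<omega>. \<forall>i\<in>J. \<omega> i \<in> A i}"
    by auto
  ultimately show ?thesis
    by simp
qed

lemma cyl_in_sets: "cyl n x \<in> sets seqs"
  using box_in_sets[of "{..n}" "\<lambda>i. {x i}"] by (simp add: Ball_def)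

lemma leaves_in_sets: "{\<omega>. \<exists>i. \<omega> i \<notin> C} \<in> sets seqs"
proof -
  have "(\<Union>i::nat. {\<omega>. \<omega> i \<in> - C}) \<in> sets seqs"
    by (intro sets.countable_UN) (auto intro: coordinate_in_sets simp del: Compl_iff)
  moreover have "(\<Union>i::nat. {\<omega>. \<omega> i \<in> - C}) = {\<omega>. \<exists>i. \<omega> i \<notin> C}"
    by auto
  ultimately show ?thesis
    by (simp only:)
qed

lemma AE_in_iff:
  assumes "sets M = sets seqs"
  shows "(AE \<omega> in M. \<forall>i. \<omega> i \<in> C) \<longleftrightarrow> emeasure M {\<omega>. \<exists>i. \<omega> i \<notin> C} = 0"
  using leaves_in_sets[of C] assms sets_eq_imp_space_eq[OF assms]
  by (subst AE_iff_measurable[OF _ refl]) (simp_all add: space_PiM)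

text \<open>Almost every sequence lives in the finite set \<open>S\<close>, so up to a null set the
  box is a finite disjoint union of cylinders, one for each admissible word of length
  \<open>n + 1\<close> over \<open>S\<close>. Words are taken from \<open>PiE\<close> so that
  distinct ones differ at some position up to \<open>n\<close>.\<close>

lemma emeasure_box_eq_sum_cyl:
  fixes M :: "(nat \<Rightarrow> 'v) measure"
  assumes sets: "sets M = sets seqs" and S: "finite S" "emeasure M {\<omega>. \<exists>i. \<omega> i \<notin> S} = 0"
    and J: "J \<subseteq> {..n}"
  shows "emeasure M {\<omega>. \<forall>i\<in>J. \<omega> i \<in> A i} =
    (\<Sum>x | x \<in> PiE {..n} (\<lambda>_. S) \<and> (\<forall>i\<in>J. x i \<in> A i). emeasure M (cyl n x))"
proof -
  have AE: "AE \<omega> in M. \<forall>i. \<omega> i \<in> S"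
    using S(2) by (simp add: AE_in_iff sets)
  let ?T = "{x \<in> PiE {..n} (\<lambda>_. S). \<forall>i\<in>J. x i \<in> A i}"
  have sets': "cyl n x \<in> sets M" for x
    by (simp add: sets cyl_in_sets)
  have fin: "finite ?T"
    using S(1) by (intro finite_subset[OF _ finite_PiE[of "{..n}" "\<lambda>_. S"]]) auto
  have box: "{\<omega>. \<forall>i\<in>J. \<omega> i \<in> A i} \<in> sets M"
    using J by (simp add: sets box_in_sets finite_subset)
  have "emeasure M {\<omega>. \<forall>i\<in>J. \<omega> i \<in> A i} = emeasure M (\<Union>x\<in>?T. cyl n x)"
  proof (rule emeasure_eq_AE)
    show "AE \<omega> in M. \<omega> \<in> {\<omega>. \<forall>i\<in>J. \<omega> i \<in> A i} \<longleftrightarrow> \<omega> \<in> (\<Union>x\<in>?T. cyl n x)"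
      using AE
    proof eventually_elim
      case (elim \<omega>)
      then have *: "restrict \<omega> {..n} \<in> PiE {..n} (\<lambda>_. S)" "\<omega> \<in> cyl n (restrict \<omega> {..n})"
        by auto
      show ?case
      proof
        assume "\<omega> \<in> {\<omega>. \<forall>i\<in>J. \<omega> i \<in> A i}"
        then have "restrict \<omega> {..n} \<in> ?T"
          using J *(1) by auto
        then show "\<omega> \<in> (\<Union>x\<in>?T. cyl n x)"
          using *(2) by blast
      next
        assume "\<omega> \<in> (\<Union>x\<in>?T. cyl n x)"
        then show "\<omega> \<in> {\<omega>. \<forall>i\<in>J. \<omega> i \<in> A i}"
          using J by fastforce
      qed
    qed
  qed (use box fin sets' in auto)
  also have "\<dots> = (\<Sum>x\<in>?T. emeasure M (cyl n x))"
  proof (rule sum_emeasure[symmetric])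
    show "disjoint_family_on (cyl n) ?T"
      unfolding disjoint_family_on_def
    proof (intro ballI impI)
      fix x y assume xy: "x \<in> ?T" "y \<in> ?T" "x \<noteq> y"
      then have "\<exists>i\<le>n. x i \<noteq> y i"
        using PiE_ext[of x "{..n}" "\<lambda>_. S" y] by auto
      then show "cyl n x \<inter> cyl n y = {}"
        by fastforce
    qed
  qed (use fin sets' in auto)
  finally show ?thesis .
qed

text \<open>Boxes over finite index sets generate the sigma-algebra, and their measures are finite
  sums of measures of cylinders over \<open>S\<close>. This criterion underlies locality, the Markov
  property and the zero-one law below.\<close>

lemma measure_eqI_cyl:
  fixes M N :: "(nat \<Rightarrow> 'v) measure"
  assumes "finite_measure M" and sets: "sets M = sets seqs" "sets N = sets seqs"
    and S: "finite S" "emeasure M {\<omega>. \<exists>i. \<omega> i \<notin> S} = 0" "emeasure N {\<omega>. \<exists>i. \<omega> i \<notin> S} = 0"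
    and eq: "\<And>n x. (\<And>i. i \<le> n \<Longrightarrow> x i \<in> S) \<Longrightarrow> emeasure M (cyl n x) = emeasure N (cyl n x)"
  shows "M = N"
proof (rule measure_eqI_PiM_infinite)
  fix J :: "nat set" and A :: "nat \<Rightarrow> 'v set"
  assume "finite J"
  then obtain n where n: "J \<subseteq> {..n}"
    using finite_nat_iff_bounded_le by blast
  have "prod_emb UNIV (\<lambda>_. count_space UNIV) J (PiE J A) = {\<omega>. \<forall>i\<in>J. \<omega> i \<in> A i}"
    by (auto simp: prod_emb_def)
  then show "emeasure M (prod_emb UNIV (\<lambda>_. count_space UNIV) J (PiE J A)) =
      emeasure N (prod_emb UNIV (\<lambda>_. count_space UNIV) J (PiE J A))"
    using emeasure_box_eq_sum_cyl[OF sets(1) S(1,2) n, of A]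
      emeasure_box_eq_sum_cyl[OF sets(2) S(1,3) n, of A]
    by (auto intro!: sum.cong eq)
qed (use assms in simp_all)


section \<open>The Markov property\<close>

text \<open>Finiteness is included so that maxima exist, expectations are finite sums, and
  \<open>C\<close> can serve as the carrier \<open>S\<close> in
  \<open>measure_eqI_cyl\<close>.\<close>

definition closed_set :: "('v \<Rightarrow> 'v pmf) \<Rightarrow> 'v set \<Rightarrow> bool" where
  "closed_set K C \<longleftrightarrow> finite C \<and> (\<forall>v\<in>C. set_pmf (K v) \<subseteq> C)"

lemma emeasure_plays_cyl:
  "emeasure (plays G f0 f1 v) (cyl n x) =
     (if x 0 = v then \<Prod>i<n. pmf (chain G f0 f1 (x i)) (x (Suc i)) else 0)"
proof -
  interpret prob_space "plays G f0 f1 v"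
    by (rule prob_space_plays)
  show ?thesis
    by (simp add: emeasure_eq_measure measure_plays_cylinder)
qed

lemma cyl_Suc: "cyl (Suc n) x = cyl n x \<inter> {\<omega>. \<omega> (Suc n) = x (Suc n)}"
  by (auto simp: le_Suc_eq)

lemma AE_plays_start: "AE \<omega> in plays G f0 f1 v. \<omega> 0 = v"
proof -
  interpret prob_space "plays G f0 f1 v"
    by (rule prob_space_plays)
  have "prob (cyl 0 (\<lambda>_. v)) = 1"
    using measure_plays_cylinder[of G f0 f1 v 0 "\<lambda>_. v"] by simp
  then have "AE \<omega> in plays G f0 f1 v. \<omega> \<in> cyl 0 (\<lambda>_. v)"
    by (subst (asm) prob_eq_1) (simp_all only: sets_plays cyl_in_sets)
  then show ?thesis
    by simp
qed

text \<open>No mass escapes in one step from a prefix that ends in \<open>C\<close>, and there are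
  only finitely many prefixes over \<open>C\<close> of each length; induction and a countable
  intersection do the rest.\<close>

lemma emeasure_plays_leaves_closed:
  assumes C: "closed_set (chain G f0 f1) C" and v: "v \<in> C"
  shows "emeasure (plays G f0 f1 v) {\<omega>. \<exists>i. \<omega> i \<notin> C} = 0"
proof -
  interpret prob_space "plays G f0 f1 v"
    by (rule prob_space_plays)
  have fin: "finite C"
    using C by (simp add: closed_set_def)
  have sets': "cyl n x \<in> events" for n x
    by (simp add: sets_plays cyl_in_sets)
  have step: "AE \<omega> in plays G f0 f1 v. \<omega> \<in> cyl n x \<longrightarrow> \<omega> (Suc n) \<in> C" if "x n \<in> C" for n x
  proof -
    let ?y = "\<lambda>y. x(Suc n := y)"
    \<comment> \<open>The extensions of the prefix by one vertex of \<open>C\<close> carry its whole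
      mass, because the transition probabilities out of \<open>x n\<close> sum to 1 over
      \<open>C\<close>.\<close>
    have "prob (\<Union>y\<in>C. cyl (Suc n) (?y y)) = (\<Sum>y\<in>C. prob (cyl (Suc n) (?y y)))"
      by (rule finite_measure_finite_Union)
        (use fin sets' in \<open>fastforce simp: disjoint_family_on_def\<close>)+
    also have "\<dots> = (\<Sum>y\<in>C. prob (cyl n x) * pmf (chain G f0 f1 (x n)) y)"
      by (rule sum.cong) (auto simp: measure_plays_cylinder)
    also have "\<dots> = prob (cyl n x)"
      using C that fin
      by (simp add: sum_distrib_left[symmetric] closed_set_def sum_pmf_eq_1)
    finally have "prob (cyl n x - (\<Union>y\<in>C. cyl (Suc n) (?y y))) = 0"
      by (subst finite_measure_Diff[OF sets' sets.finite_UN[OF fin sets']]) (auto simp: le_Suc_eq)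
    then have "AE \<omega> in plays G f0 f1 v. \<omega> \<notin> cyl n x - (\<Union>y\<in>C. cyl (Suc n) (?y y))"
      by (subst prob_eq_0[OF sets.Diff[OF sets' sets.finite_UN[OF fin sets']], symmetric])
    then show ?thesis
      by eventually_elim (auto simp: cyl_Suc)
  qed
  have "AE \<omega> in plays G f0 f1 v. \<forall>i\<le>n. \<omega> i \<in> C" for n
  proof (induction n)
    case 0
    show ?case
      using AE_plays_start[of v G f0 f1]
      by eventually_elim (use v in auto)
  next
    case (Suc n)
    have "AE \<omega> in plays G f0 f1 v. \<forall>x\<in>PiE {..n} (\<lambda>_. C). \<omega> \<in> cyl n x \<longrightarrow> \<omega> (Suc n) \<in> C"
      using fin by (intro AE_finite_allI step) (auto simp: finite_PiE)
    with Suc show ?case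
    proof eventually_elim
      case (elim \<omega>)
      then have "restrict \<omega> {..n} \<in> PiE {..n} (\<lambda>_. C)" "\<omega> \<in> cyl n (restrict \<omega> {..n})"
        by auto
      then have "\<omega> (Suc n) \<in> C"
        using elim(2) by blast
      then show ?case
        using elim(1) by (auto simp: le_Suc_eq)
    qed
  qed
  then have "AE \<omega> in plays G f0 f1 v. \<forall>n. \<forall>i\<le>n. \<omega> i \<in> C"
    by (simp add: AE_all_countable)
  then have "AE \<omega> in plays G f0 f1 v. \<forall>i. \<omega> i \<in> C"
    by eventually_elim auto
  then show ?thesis
    by (simp add: AE_in_iff sets_plays)
qed

text \<open>Cylinders over \<open>C\<close> only involve transitions out of \<open>C\<close>, and
  everything else is null. Thus a play confined to \<open>C\<close> cannot tell apart strategies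
  that agree there; this is how known values are transferred later.\<close>

lemma plays_cong_closed:
  assumes C: "closed_set (chain G f0 f1) C" and v: "v \<in> C"
    and eq: "\<And>u. u \<in> C \<Longrightarrow> chain G f0 f1 u = chain G g0 g1 u"
  shows "plays G f0 f1 v = plays G g0 g1 v"
proof (rule measure_eqI_cyl)
  have C': "closed_set (chain G g0 g1) C"
    using C eq by (simp add: closed_set_def)
  show "emeasure (plays G f0 f1 v) {\<omega>. \<exists>i. \<omega> i \<notin> C} = 0"
    "emeasure (plays G g0 g1 v) {\<omega>. \<exists>i. \<omega> i \<notin> C} = 0"
    using C C' v by (simp_all add: emeasure_plays_leaves_closed)
  show "emeasure (plays G f0 f1 v) (cyl n x) = emeasure (plays G g0 g1 v) (cyl n x)"
    if "\<And>i. i \<le> n \<Longrightarrow> x i \<in> C" for n x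
    using that by (auto simp: emeasure_plays_cyl eq intro!: arg_cong[of _ _ ennreal] prod.cong)
  show "finite_measure (plays G f0 f1 v)"
    by (simp add: prob_space_plays prob_space.finite_measure)
qed (use C in \<open>auto simp: sets_plays closed_set_def\<close>)

lemma plays_Markov:
  assumes C: "closed_set (chain G f0 f1) C" and x: "x 0 = v" "x n \<in> C" and v: "v \<in> C"
    and B: "B \<in> sets seqs"
  shows "emeasure (plays G f0 f1 v) (cyl n x \<inter> {\<omega>. (\<lambda>i. \<omega> (n + i)) \<in> B}) =
    emeasure (plays G f0 f1 v) (cyl n x) * emeasure (plays G f0 f1 (x n)) B"
proof -
  interpret prob_space "plays G f0 f1 v"
    by (rule prob_space_plays)
  let ?P = "plays G f0 f1 v" and ?s = "\<lambda>\<omega> i. \<omega> (n + i) :: 'a"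
  let ?q = "emeasure ?P (cyl n x)"
  \<comment> \<open>\<open>?D\<close> is the law of the shifted play on the event
    \<open>cyl n x\<close>, left unnormalised so that cylinders of probability 0 need no special
    treatment.\<close>
  let ?D = "distr (density ?P (indicator (cyl n x))) seqs ?s"
  have cyl: "cyl n x \<in> sets ?P" for n x
    by (simp add: sets_plays cyl_in_sets)
  have "?s \<in> measurable seqs seqs"
    by (rule measurable_PiM_single') (auto simp: space_PiM)
  then have s: "?s \<in> measurable ?P seqs"
    by (simp add: sets_plays cong: measurable_cong_sets)
  have em: "emeasure ?D B = emeasure ?P (cyl n x \<inter> {\<omega>. ?s \<omega> \<in> B})" if B: "B \<in> sets seqs" for B
  proof -
    have "{\<omega>. ?s \<omega> \<in> B} \<in> sets ?P"
      using measurable_sets[OF s B] by (simp add: space_plays vimage_def)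
    then show ?thesis
      using s B cyl
      by (simp add: emeasure_distr emeasure_density space_plays vimage_def
          indicator_inter_arith[symmetric])
  qed
  have "?D = scale_measure ?q (plays G f0 f1 (x n))"
  proof (rule measure_eqI_cyl)
    show "finite_measure ?D"
      by (rule finite_measureI) (use em[OF UNIV_in_sets] in \<open>simp add: space_PiM emeasure_eq_measure\<close>)
    have "emeasure ?D {\<omega>. \<exists>i. \<omega> i \<notin> C} \<le> emeasure ?P {\<omega>. \<exists>i. \<omega> i \<notin> C}"
      unfolding em[OF leaves_in_sets] by (rule emeasure_mono) (auto simp: sets_plays leaves_in_sets)
    then show "emeasure ?D {\<omega>. \<exists>i. \<omega> i \<notin> C} = 0"
      by (simp add: emeasure_plays_leaves_closed[OF C v])
    show "emeasure (scale_measure ?q (plays G f0 f1 (x n))) {\<omega>. \<exists>i. \<omega> i \<notin> C} = 0"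
      by (simp add: emeasure_plays_leaves_closed[OF C x(2)])
    show "emeasure ?D (cyl m y) = emeasure (scale_measure ?q (plays G f0 f1 (x n))) (cyl m y)"
      for m y
    proof (cases "y 0 = x n")
      case True
      \<comment> \<open>The two words overlap in position \<open>n\<close>, where
        \<open>x n = y 0\<close>; glued there they form one word with \<open>n + m\<close>
        transitions.\<close>
      let ?z = "\<lambda>i. if i \<le> n then x i else y (i - n)"
      let ?c = "\<lambda>x i. pmf (chain G f0 f1 (x i)) (x (Suc i))"
      have "cyl n x \<inter> {\<omega>. ?s \<omega> \<in> cyl m y} = cyl (n + m) ?z"
      proof (intro set_eqI iffI)
        fix \<omega> assume \<omega>: "\<omega> \<in> cyl n x \<inter> {\<omega>. ?s \<omega> \<in> cyl m y}"
        have "\<omega> i = ?z i" if "i \<le> n + m" for i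
        proof (cases "i \<le> n")
          case False
          then have i: "i = n + (i - n)" "i - n \<le> m"
            using that by simp_all
          have "\<forall>j\<le>m. \<omega> (n + j) = y j"
            using \<omega> by simp
          then have "\<omega> (n + (i - n)) = y (i - n)"
            using i(2) by blast
          with False show ?thesis
            by simp
        qed (use \<omega> in auto)
        then show "\<omega> \<in> cyl (n + m) ?z"
          by blast
      next
        fix \<omega> assume \<omega>: "\<omega> \<in> cyl (n + m) ?z"
        have "\<omega> (n + i) = y i" if "i \<le> m" for i
        proof -
          have "\<omega> (n + i) = ?z (n + i)"
            using \<omega> that by simp
          then show ?thesis
            using True by (cases "i = 0") simp_all
        qed
        moreover have "\<omega> i = x i" if "i \<le> n" for i
        proof -
          have "\<omega> i = ?z i"
            using \<omega> that by simp
          then show ?thesis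
            using that by simp
        qed
        ultimately show "\<omega> \<in> cyl n x \<inter> {\<omega>. ?s \<omega> \<in> cyl m y}"
          by auto
      qed
      then have "emeasure ?D (cyl m y) = ennreal (\<Prod>i<n + m. ?c ?z i)"
        by (subst em[OF cyl_in_sets]) (simp add: emeasure_plays_cyl x)
      also have "(\<Prod>i<n + m. ?c ?z i) = (\<Prod>i<n. ?c x i) * (\<Prod>i<m. ?c y i)"
      proof -
        have "(\<Prod>i<n + m. ?c ?z i) = (\<Prod>i<n. ?c ?z i) * (\<Prod>i\<in>{n..<n+m}. ?c ?z i)"
          by (subst prod.union_disjoint[symmetric]) (auto intro!: prod.cong)
        also have "(\<Prod>i\<in>{n..<n+m}. ?c ?z i) = (\<Prod>i<m. ?c ?z (i + n))"
          using prod.shift_bounds_nat_ivl[of "?c ?z" 0 n m] by (simp add: lessThan_atLeast0 add.commute)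
        also have "\<dots> = (\<Prod>i<m. ?c y i)"
          using True by (intro prod.cong) (auto simp: Suc_diff_le)
        finally show ?thesis
          by simp
      qed
      finally show ?thesis
        using True x by (simp add: emeasure_plays_cyl prod_nonneg ennreal_mult)
    next
      case False
      then have "cyl n x \<inter> {\<omega>. ?s \<omega> \<in> cyl m y} = {}"
        by force
      then show ?thesis
        using False em[OF cyl_in_sets, of m y] by (simp add: emeasure_plays_cyl)
    qed
  qed (use C in \<open>auto simp: sets_plays closed_set_def\<close>)
  then show ?thesis
    using em[OF B] by simp
qed

section \<open>Winning probabilities of a fixed pair of strategies\<close>

lemma won_by_player0_shift: "won_by_player0 G (\<lambda>i. \<omega> (n + i)) \<longleftrightarrow> won_by_player0 G \<omega>"
proof -
  have "(\<exists>\<^sub>\<infinity>i. pri G (\<omega> (n + i)) = p) \<longleftrightarrow> (\<exists>\<^sub>\<infinity>i. pri G (\<omega> i) = p)" for p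
  proof
    assume *: "\<exists>\<^sub>\<infinity>i. pri G (\<omega> (n + i)) = p"
    show "\<exists>\<^sub>\<infinity>i. pri G (\<omega> i) = p"
      unfolding INFM_nat_le
    proof
      fix m
      show "\<exists>k\<ge>m. pri G (\<omega> k) = p"
        using *[unfolded INFM_nat_le] by (metis trans_le_add2)
    qed
  next
    assume *: "\<exists>\<^sub>\<infinity>i. pri G (\<omega> i) = p"
    show "\<exists>\<^sub>\<infinity>i. pri G (\<omega> (n + i)) = p"
      unfolding INFM_nat_le
    proof
      fix m
      obtain k where "k \<ge> n + m" "pri G (\<omega> k) = p"
        using * unfolding INFM_nat_le by blast
      then show "\<exists>k\<ge>m. pri G (\<omega> (n + k)) = p"
        by (intro exI[of _ "k - n"]) auto
    qed
  qed
  then show ?thesis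
    by (simp add: won_by_player0_def)
qed

lemma emeasure_val_pair: "emeasure (plays G f0 f1 v) {\<omega>. won_by_player0 G \<omega>} = ennreal (val_pair G f0 f1 v)"
  unfolding val_pair_def
  by (rule finite_measure.emeasure_eq_measure[OF prob_space.finite_measure[OF prob_space_plays]])

lemma val_pair_nonneg: "0 \<le> val_pair G f0 f1 v"
  by (simp add: val_pair_def)

lemma val_pair_le_1: "val_pair G f0 f1 v \<le> 1"
  by (simp add: val_pair_def prob_space_plays prob_space.prob_le_1)

text \<open>Winning does not depend on a finite prefix, so the Markov property applies to it
  directly: after the prefix \<open>x\<close> only its last vertex matters.\<close>

lemma emeasure_cyl_won:
  assumes "closed_set (chain G f0 f1) C" "x 0 \<in> C" "x n \<in> C"
  shows "emeasure (plays G f0 f1 (x 0)) (cyl n x \<inter> {\<omega>. won_by_player0 G \<omega>}) =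
    emeasure (plays G f0 f1 (x 0)) (cyl n x) * ennreal (val_pair G f0 f1 (x n))"
proof -
  have "{\<omega>. won_by_player0 G \<omega>} \<in> sets seqs"
    using sets_won_by_player0[of G] by (simp add: sets_plays)
  from plays_Markov[OF assms(1) refl assms(3,2) this] show ?thesis
    by (simp add: won_by_player0_shift emeasure_val_pair)
qed

lemma val_pair_cong_closed:
  assumes "closed_set (chain G f0 f1) C" "v \<in> C"
    and "\<And>u. u \<in> C \<Longrightarrow> chain G f0 f1 u = chain G g0 g1 u"
  shows "val_pair G f0 f1 v = val_pair G g0 g1 v"
  using plays_cong_closed[OF assms] by (simp add: val_pair_def)

lemma val_pair_harmonic:
  assumes C: "closed_set (chain G f0 f1) C" and v: "v \<in> C"
  shows "val_pair G f0 f1 v = measure_pmf.expectation (chain G f0 f1 v) (val_pair G f0 f1)"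
proof -
  let ?W = "{\<omega>. won_by_player0 G \<omega>}" and ?P = "plays G f0 f1 v"
  \<comment> \<open>\<open>?x y\<close> encodes the first step from \<open>v\<close> to
    \<open>y\<close>; only its positions 0 and 1 matter. The cylinders for \<open>y\<close> in
    \<open>C\<close> split the event of winning by the first step.\<close>
  let ?x = "\<lambda>y. (\<lambda>_. v)(Suc 0 := y)"
  have fin: "finite C"
    using C by (simp add: closed_set_def)
  have W: "?W \<in> sets ?P"
    by (rule sets_won_by_player0)
  have cylW: "cyl (Suc 0) x \<inter> ?W \<in> sets ?P" for x
    using W by (intro sets.Int) (simp_all only: sets_plays cyl_in_sets)
  have "ennreal (val_pair G f0 f1 v) = emeasure ?P (\<Union>y\<in>C. cyl (Suc 0) (?x y) \<inter> ?W)"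
    unfolding emeasure_val_pair[symmetric]
  proof (rule emeasure_eq_AE)
    have "AE \<omega> in ?P. \<forall>i. \<omega> i \<in> C"
      by (simp add: AE_in_iff sets_plays emeasure_plays_leaves_closed[OF C v])
    moreover have "AE \<omega> in ?P. \<omega> 0 = v"
      by (rule AE_plays_start)
    ultimately show "AE \<omega> in ?P. \<omega> \<in> ?W \<longleftrightarrow> \<omega> \<in> (\<Union>y\<in>C. cyl (Suc 0) (?x y) \<inter> ?W)"
      by eventually_elim (auto simp: le_Suc_eq)
  next
    show "(\<Union>y\<in>C. cyl (Suc 0) (?x y) \<inter> ?W) \<in> sets ?P"
      by (intro sets.finite_UN fin cylW)
  qed (rule W)
  also have "\<dots> = (\<Sum>y\<in>C. emeasure ?P (cyl (Suc 0) (?x y) \<inter> ?W))"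
  proof (rule sum_emeasure[symmetric])
    show "(\<lambda>y. cyl (Suc 0) (?x y) \<inter> ?W) ` C \<subseteq> sets ?P"
      using cylW by blast
    show "disjoint_family_on (\<lambda>y. cyl (Suc 0) (?x y) \<inter> ?W) C"
      unfolding disjoint_family_on_def by (auto dest!: spec[of _ "Suc 0"])
  qed (rule fin)
  also have "\<dots> = (\<Sum>y\<in>C. ennreal (pmf (chain G f0 f1 v) y * val_pair G f0 f1 y))"
  proof (rule sum.cong)
    fix y assume "y \<in> C"
    then show "emeasure ?P (cyl (Suc 0) (?x y) \<inter> ?W) = ennreal (pmf (chain G f0 f1 v) y * val_pair G f0 f1 y)"
      using emeasure_cyl_won[OF C, of "?x y" "Suc 0"] v
      by (simp add: emeasure_plays_cyl ennreal_mult val_pair_nonneg)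
  qed simp
  also have "\<dots> = ennreal (\<Sum>y\<in>C. pmf (chain G f0 f1 v) y * val_pair G f0 f1 y)"
    by (rule sum_ennreal) (simp add: val_pair_nonneg)
  finally have "val_pair G f0 f1 v = (\<Sum>y\<in>C. pmf (chain G f0 f1 v) y * val_pair G f0 f1 y)"
    by (subst (asm) ennreal_inj) (auto intro!: sum_nonneg simp: val_pair_nonneg)
  also have "\<dots> = measure_pmf.expectation (chain G f0 f1 v) (val_pair G f0 f1)"
    using C v by (subst integral_measure_pmf_real[OF fin]) (auto simp: closed_set_def mult.commute)
  finally show ?thesis .
qed

text \<open>
  Constancy of the winning probability makes the event of winning independent of every cylinder, and
  hence of itself.
\<close>

lemma val_pair_zero_one:
  assumes C: "closed_set (chain G f0 f1) C" and const: "\<And>v. v \<in> C \<Longrightarrow> val_pair G f0 f1 v = c"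
    and v: "v \<in> C"
  shows "c = 0 \<or> c = 1"
proof -
  let ?W = "{\<omega>. won_by_player0 G \<omega>}" and ?P = "plays G f0 f1 v"
  interpret prob_space ?P
    by (rule prob_space_plays)
  have W: "?W \<in> sets ?P"
    by (rule sets_won_by_player0)
  have c: "c \<ge> 0"
    using const[OF v] val_pair_nonneg by metis
  have em: "emeasure (density ?P (indicator ?W)) B = emeasure ?P (B \<inter> ?W)" if "B \<in> sets seqs" for B
  proof -
    have "B \<in> sets ?P"
      using that by (simp add: sets_plays)
    then show ?thesis
      using W by (simp add: emeasure_density indicator_inter_arith[symmetric] Int_commute)
  qed
  have "density ?P (indicator ?W) = scale_measure (ennreal c) ?P"
  proof (rule measure_eqI_cyl)
    show "finite_measure (density ?P (indicator ?W))"
      by (rule finite_measureI) (use em[OF UNIV_in_sets] in \<open>simp add: space_plays emeasure_eq_measure\<close>)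
    have "emeasure (density ?P (indicator ?W)) {\<omega>. \<exists>i. \<omega> i \<notin> C} \<le> emeasure ?P {\<omega>. \<exists>i. \<omega> i \<notin> C}"
      unfolding em[OF leaves_in_sets] by (rule emeasure_mono) (auto simp: sets_plays leaves_in_sets)
    then show "emeasure (density ?P (indicator ?W)) {\<omega>. \<exists>i. \<omega> i \<notin> C} = 0"
      by (simp add: emeasure_plays_leaves_closed[OF C v])
    show "emeasure (scale_measure (ennreal c) ?P) {\<omega>. \<exists>i. \<omega> i \<notin> C} = 0"
      by (simp add: emeasure_plays_leaves_closed[OF C v])
    show "emeasure (density ?P (indicator ?W)) (cyl n x) = emeasure (scale_measure (ennreal c) ?P) (cyl n x)"
      if x: "\<And>i. i \<le> n \<Longrightarrow> x i \<in> C" for n x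
    proof (cases "x 0 = v")
      case True
      then show ?thesis
        using emeasure_cyl_won[OF C, of x n] x const v
        by (simp add: em sets_plays cyl_in_sets mult.commute)
    next
      case False
      then have "emeasure ?P (cyl n x) = 0"
        by (simp add: emeasure_plays_cyl)
      moreover from this have "emeasure ?P (cyl n x \<inter> ?W) = 0"
        by (rule emeasure_eq_0[rotated]) (simp_all only: sets_plays cyl_in_sets Int_lower1)
      ultimately show ?thesis
        by (simp add: em sets_plays cyl_in_sets)
    qed
  qed (use C in \<open>auto simp: sets_plays closed_set_def\<close>)
  then have "emeasure ?P (?W \<inter> ?W) = ennreal c * emeasure ?P ?W"
    using em[of ?W] W by (simp add: sets_plays)
  then have "ennreal c = ennreal (c * c)"
    using c by (simp add: emeasure_val_pair const[OF v] ennreal_mult)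
  then have "c = c * c"
    using c by (subst (asm) ennreal_inj) auto
  then show ?thesis
    by auto
qed


section \<open>A maximum principle\<close>

lemma expectation_mono_finite:
  fixes g h :: "'v \<Rightarrow> real"
  assumes "finite (set_pmf p)" "\<And>y. y \<in> set_pmf p \<Longrightarrow> g y \<le> h y"
  shows "measure_pmf.expectation p g \<le> measure_pmf.expectation p h"
  using assms by (intro integral_mono_AE integrable_measure_pmf_finite) (simp_all add: AE_measure_pmf_iff)

lemma expectation_cong_pmf:
  fixes g h :: "'v \<Rightarrow> real"
  assumes "\<And>y. y \<in> set_pmf p \<Longrightarrow> g y = h y"
  shows "measure_pmf.expectation p g = measure_pmf.expectation p h"
  using assms by (intro integral_cong_AE) (simp_all add: AE_measure_pmf_iff)

text \<open>The weighted deficits \<open>pmf p x * (c - g x)\<close> are nonnegative and sum to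
  \<open>c\<close> minus the expectation, which is at most 0; so each of them vanishes.\<close>

lemma expectation_ge_bound:
  fixes g :: "'v \<Rightarrow> real"
  assumes fin: "finite (set_pmf p)" and le: "\<And>y. y \<in> set_pmf p \<Longrightarrow> g y \<le> c"
    and ge: "c \<le> measure_pmf.expectation p g" and y: "y \<in> set_pmf p"
  shows "g y = c"
proof -
  have "(\<Sum>x\<in>set_pmf p. pmf p x * (c - g x)) = c * (\<Sum>x\<in>set_pmf p. pmf p x) - (\<Sum>x\<in>set_pmf p. g x * pmf p x)"
    by (simp add: algebra_simps sum_subtractf sum_distrib_left)
  also have "\<dots> = c - measure_pmf.expectation p g"
    by (subst integral_measure_pmf_real[OF fin]) (simp_all add: sum_pmf_eq_1 fin)
  finally have "(\<Sum>x\<in>set_pmf p. pmf p x * (c - g x)) \<le> 0"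
    using ge by simp
  moreover have nonneg: "\<And>x. x \<in> set_pmf p \<Longrightarrow> 0 \<le> pmf p x * (c - g x)"
    using le by (simp add: mult_nonneg_nonneg)
  ultimately have "(\<Sum>x\<in>set_pmf p. pmf p x * (c - g x)) = 0"
    using sum_nonneg[OF nonneg] by force
  then have "pmf p y * (c - g y) = 0"
    using sum_nonneg_eq_0_iff[OF fin, of "\<lambda>x. pmf p x * (c - g x)"] nonneg y by blast
  then show ?thesis
    using y by (simp add: set_pmf_iff)
qed

lemma expectation_le_bound:
  fixes g :: "'v \<Rightarrow> real"
  assumes "finite (set_pmf p)" "\<And>y. y \<in> set_pmf p \<Longrightarrow> c \<le> g y"
    and "measure_pmf.expectation p g \<le> c" "y \<in> set_pmf p"
  shows "g y = c"
  using expectation_ge_bound[of p "\<lambda>y. - g y" "- c" y] assms by simp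

lemma closed_set_finite_pmf: "closed_set K V \<Longrightarrow> v \<in> V \<Longrightarrow> finite (set_pmf (K v))"
  by (meson closed_set_def finite_subset)

text \<open>At a maximiser the average over the successors is at least the maximum, so every
  successor is a maximiser.\<close>

lemma closed_argmax:
  fixes d :: "'v \<Rightarrow> real"
  assumes V: "closed_set K V" and sub: "\<And>v. v \<in> V \<Longrightarrow> d v \<le> measure_pmf.expectation (K v) d"
  shows "closed_set K {v \<in> V. d v = Max (d ` V)}"
  unfolding closed_set_def
proof (intro conjI ballI subsetI)
  show "finite {v \<in> V. d v = Max (d ` V)}"
    using V by (simp add: closed_set_def)
next
  fix v y assume v: "v \<in> {v \<in> V. d v = Max (d ` V)}" and y: "y \<in> set_pmf (K v)"
  have le: "d x \<le> Max (d ` V)" if "x \<in> set_pmf (K v)" for x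
    using that v V by (intro Max_ge) (auto simp: closed_set_def)
  have "d y = Max (d ` V)"
    using expectation_ge_bound[OF closed_set_finite_pmf[OF V] le _ y] v sub[of v] by auto
  then show "y \<in> {v \<in> V. d v = Max (d ` V)}"
    using v y V by (auto simp: closed_set_def)
qed

lemma constant_closed_set_of_sub_super:
  fixes w u :: "'v \<Rightarrow> real"
  assumes V: "closed_set K V"
    and sub: "\<And>v. v \<in> V \<Longrightarrow> w v \<le> measure_pmf.expectation (K v) w"
    and super: "\<And>v. v \<in> V \<Longrightarrow> measure_pmf.expectation (K v) u \<le> u v"
    and v0: "v0 \<in> V" "u v0 < w v0"
  obtains C c e where "C \<subseteq> V" "C \<noteq> {}" "closed_set K C" "e < c"
    "\<And>v. v \<in> C \<Longrightarrow> w v = c" "\<And>v. v \<in> C \<Longrightarrow> u v = e"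
proof -
  define d where "d v = w v - u v" for v
  define M where "M = {v \<in> V. d v = Max (d ` V)}"
  define C where "C = {v \<in> M. w v = Max (w ` M)}"
  have fin: "finite V"
    using V by (simp add: closed_set_def)
  have "d v \<le> measure_pmf.expectation (K v) d" if "v \<in> V" for v
    using sub[OF that] super[OF that] closed_set_finite_pmf[OF V that]
    by (simp add: d_def[abs_def] integrable_measure_pmf_finite)
  then have M: "closed_set K M"
    unfolding M_def by (rule closed_argmax[OF V])
  have C: "closed_set K C"
    unfolding C_def by (rule closed_argmax[OF M]) (use sub in \<open>auto simp: M_def\<close>)
  have "Max (d ` V) \<in> d ` V"
    using fin v0 by (intro Max_in) auto
  then have "M \<noteq> {}"
    by (force simp: M_def)
  moreover have "finite M"
    using fin by (simp add: M_def)
  ultimately have "Max (w ` M) \<in> w ` M"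
    by (intro Max_in) auto
  then have "C \<noteq> {}"
    by (force simp: C_def)
  moreover have "d v0 \<le> Max (d ` V)"
    using fin v0 by (intro Max_ge) auto
  then have "0 < Max (d ` V)"
    using v0 by (simp add: d_def)
  ultimately show ?thesis
    \<comment> \<open>On \<open>C\<close> both \<open>w\<close> and \<open>d\<close> are constant,
      hence so is \<open>u\<close>, which equals \<open>w - d\<close>; the gap between
      \<open>c\<close> and \<open>e\<close> is the maximum of \<open>d\<close>, positive because of
      \<open>v0\<close>.\<close>
    using C by (intro that[of C "Max (w ` M) - Max (d ` V)" "Max (w ` M)"]) (auto simp: C_def M_def d_def)
qed


section \<open>Uniformly optimal strategies\<close>

locale parity_game_loc =
  fixes G :: "'v game"
  assumes parity_game: "parity_game G"
begin

section \<open>Basic facts on a finite game\<close>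

lemma finite_verts: "finite (verts G)"
  using parity_game by (simp add: parity_game_def verts_def)

lemma edges_verts: "(v, v') \<in> edges G \<Longrightarrow> v \<in> verts G \<and> v' \<in> verts G"
  using parity_game by (auto simp: parity_game_def)

lemma V0_verts: "v \<in> V0 G \<Longrightarrow> v \<in> verts G"
  and V1_verts: "v \<in> V1 G \<Longrightarrow> v \<in> verts G"
  and Vr_verts: "v \<in> Vr G \<Longrightarrow> v \<in> verts G"
  by (simp_all add: verts_def)

lemma verts_cases:
  assumes "v \<in> verts G"
  obtains "v \<in> V0 G" | "v \<in> V1 G" "v \<notin> V0 G" | "v \<in> Vr G" "v \<notin> V0 G" "v \<notin> V1 G"
  using assms parity_game unfolding verts_def parity_game_def by blast

lemma succ_ex: "v \<in> verts G \<Longrightarrow> \<exists>v'. (v, v') \<in> edges G"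
  using parity_game by (simp add: parity_game_def)

lemma set_pmf_trans_prob: "v \<in> Vr G \<Longrightarrow> set_pmf (trans_prob G v) = {v'. (v, v') \<in> edges G}"
  using parity_game by (simp add: parity_game_def set_eq_iff set_pmf_iff) (metis pmf_pos pmf_nonneg less_irrefl)

lemma strats0_edge: "f \<in> strats0 G \<Longrightarrow> v \<in> V0 G \<Longrightarrow> (v, f v) \<in> edges G"
  by (auto simp: strats0_def)

lemma strats1_edge: "f \<in> strats1 G \<Longrightarrow> v \<in> V1 G \<Longrightarrow> (v, f v) \<in> edges G"
  by (auto simp: strats1_def)

lemma finite_succ: "finite {v'. (v, v') \<in> edges G}"
  using edges_verts by (intro finite_subset[OF _ finite_verts]) auto

lemma finite_strats0: "finite (strats0 G)"
  using parity_game unfolding strats0_def by (intro finite_PiE finite_succ) (simp add: parity_game_def)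

lemma finite_strats1: "finite (strats1 G)"
  using parity_game unfolding strats1_def by (intro finite_PiE finite_succ) (simp add: parity_game_def)

lemma strats1_nonempty: "strats1 G \<noteq> {}"
  unfolding strats1_def using succ_ex V1_verts by (auto simp: PiE_eq_empty_iff)

lemma strats0_if:
  "f \<in> strats0 G \<Longrightarrow> g \<in> strats0 G \<Longrightarrow> (\<lambda>v. if P v then f v else g v) \<in> strats0 G"
  by (auto simp: strats0_def PiE_iff extensional_def)

lemma strats1_if:
  "f \<in> strats1 G \<Longrightarrow> g \<in> strats1 G \<Longrightarrow> (\<lambda>v. if P v then f v else g v) \<in> strats1 G"
  by (auto simp: strats1_def PiE_iff extensional_def)

lemma set_pmf_chain:
  assumes "f0 \<in> strats0 G" "f1 \<in> strats1 G" "v \<in> verts G" "y \<in> set_pmf (chain G f0 f1 v)"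
  shows "(v, y) \<in> edges G"
  using assms(3)
  by (cases rule: verts_cases)
     (use assms strats0_edge strats1_edge set_pmf_trans_prob in \<open>auto simp: chain_def\<close>)

lemma closed_verts: "f0 \<in> strats0 G \<Longrightarrow> f1 \<in> strats1 G \<Longrightarrow> closed_set (chain G f0 f1) (verts G)"
  unfolding closed_set_def using set_pmf_chain[THEN edges_verts] finite_verts by blast

lemma val_strat_le: "f1 \<in> strats1 G \<Longrightarrow> val_strat G f0 v \<le> val_pair G f0 f1 v"
  unfolding val_strat_def by (rule cINF_lower) (auto intro!: bdd_belowI[of _ 0] simp: val_pair_nonneg)

lemma val_strat_ge:
  assumes "\<And>f1. f1 \<in> strats1 G \<Longrightarrow> c \<le> val_pair G f0 f1 v"
  shows "c \<le> val_strat G f0 v"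
  unfolding val_strat_def by (rule cINF_greatest[OF strats1_nonempty assms])

text \<open>\<open>h\<close> follows at each vertex the response of smaller value, which makes the
  minimum \<open>m\<close> superharmonic. If the value of \<open>h\<close> exceeded \<open>m\<close>
  somewhere, the maximum principle would give a closed \<open>C\<close> on which both are constant
  and still differ; but \<open>h\<close> agrees with \<open>f\<close> on a nonempty closed part of
  \<open>C\<close>, or with \<open>g\<close> on all of \<open>C\<close>.\<close>

lemma better_of_two_responses:
  assumes f0: "f0 \<in> strats0 G" and f: "f \<in> strats1 G" and g: "g \<in> strats1 G"
  obtains h where "h \<in> strats1 G"
    "\<And>v. v \<in> verts G \<Longrightarrow> val_pair G f0 h v \<le> min (val_pair G f0 f v) (val_pair G f0 g v)"
proof -
  define a where "a = val_pair G f0 f"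
  define b where "b = val_pair G f0 g"
  define m where "m v = min (a v) (b v)" for v
  define h where "h v = (if a v \<le> b v then f v else g v)" for v
  have h: "h \<in> strats1 G"
    unfolding h_def by (rule strats1_if[OF f g])
  have chain_f: "chain G f0 h v = chain G f0 f v" if "a v \<le> b v" for v
    using that by (simp add: chain_def h_def)
  have chain_g: "chain G f0 h v = chain G f0 g v" if "\<not> a v \<le> b v" for v
    using that by (simp add: chain_def h_def)
  note ch = closed_verts[OF f0 h] and cf = closed_verts[OF f0 f] and cg = closed_verts[OF f0 g]
  have a: "measure_pmf.expectation (chain G f0 f v) a = a v" if "v \<in> verts G" for v
    unfolding a_def by (rule val_pair_harmonic[OF cf that, symmetric])
  have b: "measure_pmf.expectation (chain G f0 g v) b = b v" if "v \<in> verts G" for v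
    unfolding b_def by (rule val_pair_harmonic[OF cg that, symmetric])
  have super: "measure_pmf.expectation (chain G f0 h v) m \<le> m v" if v: "v \<in> verts G" for v
  proof (cases "a v \<le> b v")
    case True
    have "measure_pmf.expectation (chain G f0 f v) m \<le> measure_pmf.expectation (chain G f0 f v) a"
      by (rule expectation_mono_finite[OF closed_set_finite_pmf[OF cf v]]) (simp add: m_def)
    with True a[OF v] show ?thesis
      by (simp add: chain_f m_def)
  next
    case False
    have "measure_pmf.expectation (chain G f0 g v) m \<le> measure_pmf.expectation (chain G f0 g v) b"
      by (rule expectation_mono_finite[OF closed_set_finite_pmf[OF cg v]]) (simp add: m_def)
    with False b[OF v] show ?thesis
      by (simp add: chain_g m_def)
  qed
  have "val_pair G f0 h v \<le> m v" if v: "v \<in> verts G" for v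
  proof (rule ccontr)
    assume "\<not> ?thesis"
    then have less: "m v < val_pair G f0 h v"
      by simp
    obtain C c e where C: "C \<subseteq> verts G" "C \<noteq> {}" "closed_set (chain G f0 h) C" "e < c"
      "\<And>v. v \<in> C \<Longrightarrow> val_pair G f0 h v = c" "\<And>v. v \<in> C \<Longrightarrow> m v = e"
      by (rule constant_closed_set_of_sub_super[OF ch eq_refl[OF val_pair_harmonic[OF ch]] super v less])
        (assumption | rule that)+
    \<comment> \<open>\<open>A\<close> is closed: at its points \<open>a\<close> equals
      \<open>e\<close>, a lower bound of \<open>a\<close> on \<open>C\<close>, and \<open>a\<close>
      is harmonic for \<open>f\<close>, so all successors have \<open>a = e\<close> as well and lie
      in \<open>A\<close>.\<close>
    define A where "A = {v \<in> C. a v \<le> b v}"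
    have "closed_set (chain G f0 h) A"
      unfolding closed_set_def
    proof (intro conjI ballI subsetI)
      show "finite A"
        using C(3) by (simp add: A_def closed_set_def)
    next
      fix x y assume x: "x \<in> A" and y: "y \<in> set_pmf (chain G f0 h x)"
      have yC: "z \<in> C" if "z \<in> set_pmf (chain G f0 h x)" for z
        using x that C(3) by (auto simp: A_def closed_set_def)
      have x': "x \<in> verts G" "a x = e" "chain G f0 h x = chain G f0 f x"
        using x C(1) C(6)[of x] chain_f by (auto simp: A_def m_def)
      have "a y = e"
      proof (rule expectation_le_bound[of "chain G f0 h x" e a])
        show "finite (set_pmf (chain G f0 h x))"
          by (rule closed_set_finite_pmf[OF ch x'(1)])
        show "e \<le> a z" if "z \<in> set_pmf (chain G f0 h x)" for z
          using C(6)[OF yC[OF that]] by (simp add: m_def)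
        show "measure_pmf.expectation (chain G f0 h x) a \<le> e"
          using a[OF x'(1)] x' by simp
      qed (rule y)
      then show "y \<in> A"
        using yC[OF y] C(6)[OF yC[OF y]] by (auto simp: A_def m_def)
    qed
    note A = val_pair_cong_closed[OF this]
    obtain x where x: "x \<in> C"
      using C(2) by blast
    show False
    \<comment> \<open>If \<open>A\<close> is empty, \<open>h\<close> plays \<open>g\<close> on all
      of \<open>C\<close>; otherwise it plays \<open>f\<close> on the closed set \<open>A\<close>.
      Either way its value equals \<open>m\<close> at some point of \<open>C\<close>, against
      \<open>e < c\<close>.\<close>
    proof (cases "A = {}")
      case True
      then have "\<not> a y \<le> b y" if "y \<in> C" for y
        using that by (auto simp: A_def)
      then have "val_pair G f0 h x = b x" "m x = b x"
        unfolding m_def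
        using x val_pair_cong_closed[OF C(3) x chain_g] by (fastforce simp: b_def)+
      then show False
        using C(4) C(5,6)[OF x] by simp
    next
      case False
      then obtain y where y: "y \<in> A"
        by blast
      have "val_pair G f0 h y = a y"
        unfolding a_def by (rule A[OF y chain_f]) (simp add: A_def)
      moreover have "m y = a y" "y \<in> C"
        using y by (simp_all add: A_def m_def)
      ultimately show False
        using C(4) C(5,6)[of y] by simp
    qed
  qed
  then show ?thesis
    using h that by (simp add: m_def a_def b_def)
qed

text \<open>The better of two responses is folded over the finitely many strategies of Player 1, so
  one response attains the infimum at all vertices simultaneously.\<close>

lemma best_response:
  assumes f0: "f0 \<in> strats0 G"
  obtains h where "h \<in> strats1 G" "\<And>v. v \<in> verts G \<Longrightarrow> val_strat G f0 v = val_pair G f0 h v"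
proof -
  have "\<exists>h\<in>strats1 G. \<forall>g\<in>S. \<forall>v\<in>verts G. val_pair G f0 h v \<le> val_pair G f0 g v"
    if "finite S" "S \<subseteq> strats1 G" for S
    using that
  proof (induction S rule: finite_induct)
    case empty
    then show ?case
      using strats1_nonempty by auto
  next
    case (insert g S)
    then obtain h where h: "h \<in> strats1 G" "\<And>g v. g \<in> S \<Longrightarrow> v \<in> verts G \<Longrightarrow> val_pair G f0 h v \<le> val_pair G f0 g v"
      by auto
    obtain k where k: "k \<in> strats1 G"
      "\<And>v. v \<in> verts G \<Longrightarrow> val_pair G f0 k v \<le> min (val_pair G f0 h v) (val_pair G f0 g v)"
      using better_of_two_responses[OF f0 h(1)] insert.prems by blast
    have "val_pair G f0 k v \<le> val_pair G f0 g' v" if "g' \<in> insert g S" "v \<in> verts G" for g' v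
      using that k(2)[of v] h(2)[of g' v] by auto
    with k(1) show ?case
      by blast
  qed
  from this[OF finite_strats1 subset_refl] obtain h where h: "h \<in> strats1 G"
    "\<And>g v. g \<in> strats1 G \<Longrightarrow> v \<in> verts G \<Longrightarrow> val_pair G f0 h v \<le> val_pair G f0 g v"
    by blast
  show ?thesis
  proof (rule that[OF h(1)])
    fix v assume "v \<in> verts G"
    then show "val_strat G f0 v = val_pair G f0 h v"
      by (intro antisym val_strat_le val_strat_ge h)
  qed
qed

section \<open>One-step behaviour of the value of a strategy\<close>

lemma val_strat_nonneg: "0 \<le> val_strat G f0 v"
  by (rule val_strat_ge) (rule val_pair_nonneg)

lemma val_strat_le_1: "val_strat G f0 v \<le> 1"
proof -
  obtain f1 where "f1 \<in> strats1 G"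
    using strats1_nonempty by blast
  from val_strat_le[OF this] show ?thesis
    by (rule order_trans[OF _ val_pair_le_1])
qed

lemma val_strat_harmonic:
  assumes f0: "f0 \<in> strats0 G" and h: "h \<in> strats1 G"
    and eq: "\<And>v. v \<in> verts G \<Longrightarrow> val_strat G f0 v = val_pair G f0 h v" and v: "v \<in> verts G"
  shows "measure_pmf.expectation (chain G f0 h v) (val_strat G f0) = val_strat G f0 v"
proof -
  have "measure_pmf.expectation (chain G f0 h v) (val_strat G f0) =
      measure_pmf.expectation (chain G f0 h v) (val_pair G f0 h)"
    by (rule expectation_cong_pmf) (use set_pmf_chain[OF f0 h v] edges_verts eq in blast)
  then show ?thesis
    using val_pair_harmonic[OF closed_verts[OF f0 h] v] eq[OF v] by simp
qed

lemma val_strat_V0: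
  assumes f0: "f0 \<in> strats0 G" and v: "v \<in> V0 G"
  shows "val_strat G f0 (f0 v) = val_strat G f0 v"
proof -
  obtain h where h: "h \<in> strats1 G" "\<And>v. v \<in> verts G \<Longrightarrow> val_strat G f0 v = val_pair G f0 h v"
    using that by (rule best_response[OF f0])
  show ?thesis
    using val_strat_harmonic[OF f0 h V0_verts[OF v]] v by (simp add: chain_def)
qed

lemma val_strat_Vr:
  assumes f0: "f0 \<in> strats0 G" and v: "v \<in> Vr G"
  shows "measure_pmf.expectation (trans_prob G v) (val_strat G f0) = val_strat G f0 v"
proof -
  obtain h where h: "h \<in> strats1 G" "\<And>v. v \<in> verts G \<Longrightarrow> val_strat G f0 v = val_pair G f0 h v"
    using that by (rule best_response[OF f0])
  have "v \<notin> V0 G" "v \<notin> V1 G"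
    using v parity_game by (auto simp: parity_game_def)
  then show ?thesis
    using val_strat_harmonic[OF f0 h Vr_verts[OF v]] by (simp add: chain_def)
qed

text \<open>Otherwise a best response \<open>h\<close> redirected at \<open>v\<close> to
  \<open>v'\<close> would push the value at \<open>v\<close> below the infimum. The value of
  \<open>f0\<close> is superharmonic for the redirected \<open>g\<close>, so by the maximum
  principle it bounds the winning probabilities under \<open>g\<close>.\<close>

lemma val_strat_V1:
  assumes f0: "f0 \<in> strats0 G" and v: "v \<in> V1 G" and e: "(v, v') \<in> edges G"
  shows "val_strat G f0 v \<le> val_strat G f0 v'"
proof (rule ccontr)
  assume "\<not> ?thesis"
  then have less: "val_strat G f0 v' < val_strat G f0 v"
    by simp
  obtain h where h: "h \<in> strats1 G" "\<And>v. v \<in> verts G \<Longrightarrow> val_strat G f0 v = val_pair G f0 h v"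
    using that by (rule best_response[OF f0])
  define g where "g = h(v := v')"
  have g: "g \<in> strats1 G"
    using h(1) v e by (auto simp: g_def strats1_def PiE_iff extensional_def)
  have v0: "v \<notin> V0 G" "v \<in> verts G" "v' \<in> verts G"
    using v e edges_verts parity_game by (auto simp: parity_game_def)
  note cg = closed_verts[OF f0 g]
  have chain_g: "chain G f0 g x = chain G f0 h x" if "x \<noteq> v" for x
    using that by (simp add: chain_def g_def)
  have chain_v: "chain G f0 g v = return_pmf v'"
    using v v0 by (simp add: chain_def g_def)
  have super: "measure_pmf.expectation (chain G f0 g x) (val_strat G f0) \<le> val_strat G f0 x"
    if x: "x \<in> verts G" for x
    using val_strat_harmonic[OF f0 h x] less chain_v chain_g[of x] by (cases "x = v") auto
  have le: "val_pair G f0 g x \<le> val_strat G f0 x" if x: "x \<in> verts G" for x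
  proof (rule ccontr)
    assume "\<not> ?thesis"
    then have less': "val_strat G f0 x < val_pair G f0 g x"
      by simp
    obtain C c d where C: "C \<subseteq> verts G" "C \<noteq> {}" "closed_set (chain G f0 g) C" "d < c"
      "\<And>v. v \<in> C \<Longrightarrow> val_pair G f0 g v = c" "\<And>v. v \<in> C \<Longrightarrow> val_strat G f0 v = d"
      by (rule constant_closed_set_of_sub_super[OF cg eq_refl[OF val_pair_harmonic[OF cg]] super x less'])
        (assumption | rule that)+
    \<comment> \<open>A closed \<open>C\<close> containing \<open>v\<close> would contain
      \<open>v'\<close>, although the value of \<open>f0\<close> is constant on \<open>C\<close> and
      differs at the two. Hence \<open>g\<close> is \<open>h\<close> on \<open>C\<close>, where the
      value is known.\<close>
    have "v \<notin> C"
    proof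
      assume "v \<in> C"
      moreover from this have "v' \<in> C"
        using C(3) chain_v by (auto simp: closed_set_def)
      ultimately show False
        using C(6)[of v] C(6)[of v'] less by simp
    qed
    moreover obtain y where y: "y \<in> C"
      using C(2) by blast
    ultimately have "val_pair G f0 g y = val_pair G f0 h y"
      by (intro val_pair_cong_closed[OF C(3)] chain_g) auto
    then show False
      using y C(1,4) C(5,6)[OF y] h(2)[of y] by auto
  qed
  have "val_pair G f0 g v = val_pair G f0 g v'"
    using val_pair_harmonic[OF cg v0(2)] by (simp add: chain_v)
  then show False
    using val_strat_le[OF g, of f0 v] le[OF v0(3)] less by simp
qed

text \<open>Equality holds at vertices of Player 0 and at random ones; a move of Player 1 can only
  raise the value.\<close>

lemma val_strat_sub:
  assumes f0: "f0 \<in> strats0 G" and f1: "f1 \<in> strats1 G" and v: "v \<in> verts G"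
  shows "val_strat G f0 v \<le> measure_pmf.expectation (chain G f0 f1 v) (val_strat G f0)"
  using v
proof (cases rule: verts_cases)
  case 1
  then show ?thesis
    using val_strat_V0[OF f0] by (simp add: chain_def)
next
  case 2
  then show ?thesis
    using val_strat_V1[OF f0 _ strats1_edge[OF f1]] by (simp add: chain_def)
next
  case 3
  then show ?thesis
    using val_strat_Vr[OF f0] by (simp add: chain_def)
qed

text \<open>The maximum principle as a tool for lower bounds on the value of \<open>h\<close>.
  Subharmonicity alone does not suffice, since every constant is subharmonic; \<open>const\<close>
  rules out closed sets on which a constant \<open>w\<close> exceeds the winning probability
  everywhere.\<close>

lemma subharmonic_le_val_strat:
  assumes h: "h \<in> strats0 G"
    and sub: "\<And>f1 v. f1 \<in> strats1 G \<Longrightarrow> v \<in> verts G \<Longrightarrow> w v \<le> measure_pmf.expectation (chain G h f1 v) w"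
    and const: "\<And>f1 C c. f1 \<in> strats1 G \<Longrightarrow> C \<subseteq> verts G \<Longrightarrow> C \<noteq> {} \<Longrightarrow> closed_set (chain G h f1) C \<Longrightarrow>
      (\<And>v. v \<in> C \<Longrightarrow> w v = c) \<Longrightarrow> \<exists>v\<in>C. c \<le> val_pair G h f1 v"
    and v: "v \<in> verts G"
  shows "w v \<le> val_strat G h v"
proof (rule ccontr)
  assume "\<not> ?thesis"
  then obtain f1 where f1: "f1 \<in> strats1 G" and less: "val_pair G h f1 v < w v"
    using val_strat_ge[of "w v" h v] by force
  note cl = closed_verts[OF h f1]
  obtain C c e where C: "C \<subseteq> verts G" "C \<noteq> {}" "closed_set (chain G h f1) C" "e < c"
      "\<And>v. v \<in> C \<Longrightarrow> w v = c" "\<And>v. v \<in> C \<Longrightarrow> val_pair G h f1 v = e"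
    by (rule constant_closed_set_of_sub_super[OF cl sub[OF f1] eq_refl[OF val_pair_harmonic[OF cl, symmetric]] v less])
      (assumption | rule that)+
  then show False
    using const[OF f1 C(1,2,3,5)] by force
qed

text \<open>Dual to \<open>better_of_two_responses\<close>, with the maximum in place of the minimum
  and \<open>subharmonic_le_val_strat\<close> for the contradiction. Ties go to \<open>f\<close>, on
  which \<open>uniformly_optimal0\<close> relies.\<close>

lemma better_of_two_strategies:
  assumes f: "f \<in> strats0 G" and g: "g \<in> strats0 G"
  defines "h \<equiv> \<lambda>v. if val_strat G g v \<le> val_strat G f v then f v else g v"
  shows "h \<in> strats0 G"
    and "v \<in> verts G \<Longrightarrow> max (val_strat G f v) (val_strat G g v) \<le> val_strat G h v"
proof -
  define a where "a = val_strat G f"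
  define b where "b = val_strat G g"
  define m where "m v = max (a v) (b v)" for v
  show h: "h \<in> strats0 G"
    unfolding h_def by (rule strats0_if[OF f g])
  have chain_f: "chain G h f1 v = chain G f f1 v" if "b v \<le> a v" for v f1
    using that by (simp add: chain_def h_def a_def b_def)
  have chain_g: "chain G h f1 v = chain G g f1 v" if "\<not> b v \<le> a v" for v f1
    using that by (simp add: chain_def h_def a_def b_def)
  have "m v \<le> val_strat G h v" if v: "v \<in> verts G"
  proof (rule subharmonic_le_val_strat[OF h])
    fix f1 v assume f1: "f1 \<in> strats1 G" and v: "v \<in> verts G"
    note fin = closed_set_finite_pmf[OF closed_verts[OF h f1] v]
    show "m v \<le> measure_pmf.expectation (chain G h f1 v) m"
    proof (cases "b v \<le> a v")
      case True
      have "a v \<le> measure_pmf.expectation (chain G h f1 v) a"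
        using val_strat_sub[OF f f1 v] True by (simp add: chain_f a_def)
      also have "\<dots> \<le> measure_pmf.expectation (chain G h f1 v) m"
        by (rule expectation_mono_finite[OF fin]) (simp add: m_def)
      finally show ?thesis
        using True by (simp add: m_def)
    next
      case False
      have "b v \<le> measure_pmf.expectation (chain G h f1 v) b"
        using val_strat_sub[OF g f1 v] False by (simp add: chain_g b_def)
      also have "\<dots> \<le> measure_pmf.expectation (chain G h f1 v) m"
        by (rule expectation_mono_finite[OF fin]) (simp add: m_def)
      finally show ?thesis
        using False by (simp add: m_def)
    qed
  next
    fix f1 C c
    assume f1: "f1 \<in> strats1 G" and C: "C \<subseteq> verts G" "C \<noteq> {}" "closed_set (chain G h f1) C"
      and c: "\<And>v. v \<in> C \<Longrightarrow> m v = c"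
    \<comment> \<open>\<open>A\<close> is closed: at its points \<open>a\<close> equals
      \<open>c\<close>, an upper bound of \<open>a\<close> on \<open>C\<close>, and \<open>a\<close>
      is subharmonic for \<open>f\<close>, so \<open>a\<close> equals \<open>c\<close> at all
      successors too.\<close>
    define A where "A = {v \<in> C. b v \<le> a v}"
    have "closed_set (chain G h f1) A"
      unfolding closed_set_def
    proof (intro conjI ballI subsetI)
      show "finite A"
        using C(3) by (simp add: A_def closed_set_def)
    next
      fix x y assume x: "x \<in> A" and y: "y \<in> set_pmf (chain G h f1 x)"
      have yC: "z \<in> C" if "z \<in> set_pmf (chain G h f1 x)" for z
        using x that C(3) by (auto simp: A_def closed_set_def)
      have x': "x \<in> verts G" "a x = c" "chain G h f1 x = chain G f f1 x"
        using x C(1) c[of x] chain_f by (auto simp: A_def m_def)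
      have "a y = c"
      proof (rule expectation_ge_bound[of "chain G h f1 x" a c])
        show "finite (set_pmf (chain G h f1 x))"
          by (rule closed_set_finite_pmf[OF closed_verts[OF h f1] x'(1)])
        show "a z \<le> c" if "z \<in> set_pmf (chain G h f1 x)" for z
          using c[OF yC[OF that]] by (simp add: m_def)
        show "c \<le> measure_pmf.expectation (chain G h f1 x) a"
          using val_strat_sub[OF f f1 x'(1)] x' by (simp add: a_def)
      qed (rule y)
      then show "y \<in> A"
        using yC[OF y] c[OF yC[OF y]] by (auto simp: A_def m_def)
    qed
    note A = val_pair_cong_closed[OF this]
    show "\<exists>v\<in>C. c \<le> val_pair G h f1 v"
    proof (cases "A = {}")
      case True
      obtain x where x: "x \<in> C"
        using C(2) by blast
      have "val_pair G h f1 x = val_pair G g f1 x"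
        by (rule val_pair_cong_closed[OF C(3) x]) (use True chain_g in \<open>auto simp: A_def\<close>)
      moreover have "b x = c"
        using True x c[OF x] by (auto simp: A_def m_def)
      ultimately have "c \<le> val_pair G h f1 x"
        using val_strat_le[OF f1, of g x] by (simp add: b_def)
      with x show ?thesis
        by blast
    next
      case False
      then obtain x where x: "x \<in> A"
        by blast
      have "val_pair G h f1 x = val_pair G f f1 x"
        by (rule A[OF x]) (use chain_f in \<open>auto simp: A_def\<close>)
      moreover have "x \<in> C" "a x = c"
        using x c[of x] by (auto simp: A_def m_def)
      ultimately have "x \<in> C" "c \<le> val_pair G h f1 x"
        using val_strat_le[OF f1, of f x] by (simp_all add: a_def)
      then show ?thesis
        by blast
    qed
  qed (rule v)
  then show "v \<in> verts G \<Longrightarrow> max (val_strat G f v) (val_strat G g v) \<le> val_strat G h v"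
    by (simp add: m_def a_def b_def)
qed

text \<open>The better of two strategies is folded over the finitely many strategies, starting from
  \<open>f\<close>. Where \<open>f\<close> has value 1 it is never beaten strictly, so ties keep its
  choice; the definition of \<open>additional_improvements\<close> asks for this agreement with
  \<open>f\<close>.\<close>

lemma uniformly_optimal0:
  assumes f: "f \<in> strats0 G"
  obtains h where "h \<in> strats0 G"
    "\<And>g v. g \<in> strats0 G \<Longrightarrow> v \<in> verts G \<Longrightarrow> val_strat G g v \<le> val_strat G h v"
    "\<And>v. v \<in> verts G \<Longrightarrow> val_strat G f v = 1 \<Longrightarrow> h v = f v"
proof -
  have "\<exists>h\<in>strats0 G. (\<forall>g\<in>insert f S. \<forall>v\<in>verts G. val_strat G g v \<le> val_strat G h v) \<and>
      (\<forall>v\<in>verts G. val_strat G f v = 1 \<longrightarrow> h v = f v)"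
    if "finite S" "S \<subseteq> strats0 G" for S
    using that
  proof (induction S rule: finite_induct)
    case empty
    then show ?case
      using f by auto
  next
    case (insert g S)
    then have "S \<subseteq> strats0 G"
      by simp
    from insert.IH[OF this] obtain h where h: "h \<in> strats0 G"
      and "\<forall>g\<in>insert f S. \<forall>v\<in>verts G. val_strat G g v \<le> val_strat G h v"
      and "\<forall>v\<in>verts G. val_strat G f v = 1 \<longrightarrow> h v = f v"
      by blast
    then have h2: "\<And>g v. g \<in> insert f S \<Longrightarrow> v \<in> verts G \<Longrightarrow> val_strat G g v \<le> val_strat G h v"
      and h3: "\<And>v. v \<in> verts G \<Longrightarrow> val_strat G f v = 1 \<Longrightarrow> h v = f v"
      by blast+
    define k where "k = (\<lambda>v. if val_strat G g v \<le> val_strat G h v then h v else g v)"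
    have k: "k \<in> strats0 G"
      "\<And>v. v \<in> verts G \<Longrightarrow> max (val_strat G h v) (val_strat G g v) \<le> val_strat G k v"
      using better_of_two_strategies[OF h, of g] insert.prems by (auto simp: k_def)
    have "val_strat G g' v \<le> val_strat G k v" if "g' \<in> insert f (insert g S)" "v \<in> verts G" for g' v
      using that k(2)[of v] h2[of g' v] by auto
    moreover have "k v = f v" if v: "v \<in> verts G" "val_strat G f v = 1" for v
      using h2[of f v] h3[of v] v val_strat_le_1[of g v] by (auto simp: k_def)
    ultimately show ?case
      using k(1) by blast
  qed
  from this[OF finite_strats0 subset_refl] show ?thesis
    using that by blast
qed


section \<open>Improvements\<close>

text \<open>A switch leads to a vertex of larger value under \<open>f\<close>, so that value is
  subharmonic for \<open>f'\<close>.\<close>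

lemma improvements_le:
  assumes f: "f \<in> strats0 G" and f': "f' \<in> improvements G f" and v: "v \<in> verts G"
  shows "val_strat G f v \<le> val_strat G f' v"
proof (rule subharmonic_le_val_strat)
  show f'0: "f' \<in> strats0 G"
    using f' by (simp add: improvements_def)
  have switch: "f' v = f v \<or> val_strat G f v < val_strat G f (f' v)" if "v \<in> V0 G" for v
    using f' that by (auto simp: improvements_def profit_def)
  fix f1 v assume f1: "f1 \<in> strats1 G" and v: "v \<in> verts G"
  show "val_strat G f v \<le> measure_pmf.expectation (chain G f' f1 v) (val_strat G f)"
  proof (cases "v \<in> V0 G \<and> f' v \<noteq> f v")
    case True
    then show ?thesis
      using switch[of v] by (simp add: chain_def)
  next
    case False
    then have "chain G f' f1 v = chain G f f1 v"
      by (auto simp: chain_def)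
    then show ?thesis
      using val_strat_sub[OF f f1 v] by simp
  qed
next
  fix f1 C c
  assume f1: "f1 \<in> strats1 G" and C: "C \<subseteq> verts G" "C \<noteq> {}" "closed_set (chain G f' f1) C"
    and c: "\<And>v. v \<in> C \<Longrightarrow> val_strat G f v = c"
  obtain x where x: "x \<in> C"
    using C(2) by blast
  \<comment> \<open>A switch at \<open>y\<close> would strictly raise the value along an edge inside
    \<open>C\<close>, where it is constant; so \<open>f'\<close> plays \<open>f\<close> on
    \<open>C\<close>.\<close>
  have "chain G f' f1 y = chain G f f1 y" if y: "y \<in> C" for y
  proof (cases "y \<in> V0 G")
    case True
    then have "f' y \<in> C"
      using y C(3) by (auto simp: closed_set_def chain_def)
    then have "\<not> val_strat G f y < val_strat G f (f' y)"
      using c y by simp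
    then show ?thesis
      using True f' by (auto simp: improvements_def profit_def chain_def)
  next
    case False
    then show ?thesis
      by (simp add: chain_def)
  qed
  then have "val_pair G f' f1 x = val_pair G f f1 x"
    by (rule val_pair_cong_closed[OF C(3) x])
  then have "c \<le> val_pair G f' f1 x"
    using val_strat_le[OF f1, of f x] c[OF x] by simp
  with x show "\<exists>v\<in>C. c \<le> val_pair G f' f1 v"
    by blast
qed (rule v)

text \<open>The gain is visible at a switched vertex: the value of \<open>f\<close> grows strictly
  along the new edge, while the value of \<open>f'\<close> does not change along it.\<close>

lemma improvements_less:
  assumes f: "f \<in> strats0 G" and f': "f' \<in> improvements G f"
  shows "\<exists>v\<in>verts G. val_strat G f v < val_strat G f' v"
proof -
  have f'0: "f' \<in> strats0 G" and ne: "f' \<noteq> f"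
    using f' by (simp_all add: improvements_def)
  have "\<exists>v\<in>V0 G. f' v \<noteq> f v"
    using ne PiE_ext[OF f'0[unfolded strats0_def] f[unfolded strats0_def]] by blast
  then obtain v where v: "v \<in> V0 G" "f' v \<noteq> f v"
    by blast
  then have "val_strat G f v < val_strat G f (f' v)"
    using f' by (auto simp: improvements_def profit_def)
  also have "\<dots> \<le> val_strat G f' (f' v)"
    using improvements_le[OF f f'] strats0_edge[OF f'0 v(1)] edges_verts by blast
  also have "\<dots> = val_strat G f' v"
    by (rule val_strat_V0[OF f'0 v(1)])
  finally show ?thesis
    using V0_verts[OF v(1)] by blast
qed

lemma no_improvements:
  assumes f: "f \<in> strats0 G" and none: "improvements G f = {}"
    and v: "v \<in> V0 G" "(v, v') \<in> edges G"
  shows "val_strat G f v' \<le> val_strat G f v"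
proof (rule ccontr)
  assume "\<not> ?thesis"
  then have less: "val_strat G f v < val_strat G f v'"
    by simp
  have "f(v := v') \<in> strats0 G"
    using f v by (auto simp: strats0_def PiE_iff extensional_def)
  moreover have "v' \<noteq> f v"
    using less val_strat_V0[OF f v(1)] by auto
  then have "f(v := v') \<noteq> f"
    by (metis fun_upd_same)
  moreover have "(v, v') \<in> profit G f"
    using less v edges_verts by (auto simp: profit_def E0_def)
  ultimately have "f(v := v') \<in> improvements G f"
    by (simp add: improvements_def)
  with none show False
    by simp
qed

end


section \<open>Additional improvements\<close>

lemma neutral_subgame_simps [simp]:
  "V0 (neutral_subgame G f) = V0 G" "V1 (neutral_subgame G f) = V1 G" "Vr (neutral_subgame G f) = Vr G"
  "trans_prob (neutral_subgame G f) = trans_prob G" "pri (neutral_subgame G f) = pri G"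
  "verts (neutral_subgame G f) = verts G"
  by (simp_all add: neutral_subgame_def verts_def)

text \<open>Edges enter a play only through the strategies, so removing edges restricts the choice
  of strategies but not what a given pair achieves.\<close>

lemma val_pair_neutral_subgame [simp]: "val_pair (neutral_subgame G f) f0 f1 v = val_pair G f0 f1 v"
proof -
  have "chain (neutral_subgame G f) = chain G"
    by (intro ext) (simp add: chain_def)
  then have "plays (neutral_subgame G f) f0 f1 v = plays G f0 f1 v"
    unfolding plays_def play_kernel_def[abs_def] by (simp only:)
  then show ?thesis
    by (simp add: val_pair_def won_by_player0_def)
qed

context parity_game_loc
begin

lemma edges_neutral:
  "(v, v') \<in> edges (neutral_subgame G f) \<longleftrightarrow>
     (v, v') \<in> edges G \<and> (v \<in> Vr G \<or> val_strat G f v' = val_strat G f v)"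
  using edges_verts[of v v']
  by (auto simp: neutral_subgame_def neutral_def Er_def E0_def E1_def verts_def)

lemma strats0_neutral:
  "f' \<in> strats0 (neutral_subgame G f) \<longleftrightarrow>
     f' \<in> strats0 G \<and> (\<forall>v\<in>V0 G. val_strat G f (f' v) = val_strat G f v)"
proof -
  have "v \<notin> Vr G" if "v \<in> V0 G" for v
    using that parity_game by (auto simp: parity_game_def)
  then show ?thesis
    by (auto simp: strats0_def PiE_iff edges_neutral)
qed

lemma strats1_neutral:
  "f' \<in> strats1 (neutral_subgame G f) \<longleftrightarrow>
     f' \<in> strats1 G \<and> (\<forall>v\<in>V1 G. val_strat G f (f' v) = val_strat G f v)"
proof -
  have "v \<notin> Vr G" if "v \<in> V1 G" for v
    using that parity_game by (auto simp: parity_game_def)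
  then show ?thesis
    by (auto simp: strats1_def PiE_iff edges_neutral)
qed

text \<open>The value is harmonic under a best response, and at a vertex of Player 1 there is a
  single successor, which therefore has the same value.\<close>

lemma best_response_neutral:
  assumes f: "f \<in> strats0 G" and h: "h \<in> strats1 G"
    and eq: "\<And>v. v \<in> verts G \<Longrightarrow> val_strat G f v = val_pair G f h v"
  shows "h \<in> strats1 (neutral_subgame G f)"
  unfolding strats1_neutral
proof (intro conjI ballI h)
  fix v assume v: "v \<in> V1 G"
  then have "v \<notin> V0 G"
    using parity_game by (auto simp: parity_game_def)
  then show "val_strat G f (h v) = val_strat G f v"
    using val_strat_harmonic[OF f h eq V1_verts[OF v]] v by (simp add: chain_def)
qed

text \<open>Every vertex keeps a successor: the choices of \<open>f\<close> and of a best response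
  preserve the value, and random vertices lose no edge.\<close>

lemma parity_game_neutral:
  assumes f: "f \<in> strats0 G"
  shows "parity_game (neutral_subgame G f)"
proof -
  obtain h where h: "h \<in> strats1 G" "\<And>v. v \<in> verts G \<Longrightarrow> val_strat G f v = val_pair G f h v"
    using that by (rule best_response[OF f])
  have "\<exists>v'. (v, v') \<in> edges (neutral_subgame G f)" if v: "v \<in> verts G" for v
    using v
  proof (cases rule: verts_cases)
    case 1
    then show ?thesis
      using strats0_edge[OF f] val_strat_V0[OF f] by (auto simp: edges_neutral)
  next
    case 2
    then show ?thesis
      using best_response_neutral[OF f h] strats1_edge[OF h(1)] by (auto simp: edges_neutral strats1_neutral)
  next
    case 3
    then show ?thesis
      using succ_ex[OF v] by (auto simp: edges_neutral)
  qed
  moreover have "edges (neutral_subgame G f) \<subseteq> verts G \<times> verts G"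
    using edges_verts by (auto simp: edges_neutral)
  ultimately show ?thesis
    using parity_game by (simp add: parity_game_def edges_neutral)
qed

end

locale strategy0_loc = parity_game_loc +
  fixes f :: "'a \<Rightarrow> 'a"
  assumes f: "f \<in> strats0 G"
begin

abbreviation w where "w \<equiv> val_strat G f"
abbreviation H where "H \<equiv> neutral_subgame G f"

sublocale neutral: parity_game_loc H
  by unfold_locales (rule parity_game_neutral[OF f])

lemma f_neutral: "f \<in> strats0 H"
  using f val_strat_V0[OF f] by (simp add: strats0_neutral)

text \<open>Player 1 has fewer strategies in the subgame, so the infimum ranges over a smaller
  set.\<close>

lemma val_strat_neutral_ge: "val_strat G f' v \<le> val_strat H f' v"
  by (rule neutral.val_strat_ge) (simp add: strats1_neutral val_strat_le)

text \<open>\<open>f\<close> is itself a strategy of the subgame and loses no value there. Hence the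
  two regions differ only if the subgame has a winning vertex with \<open>w\<close> below 1.\<close>

lemma winning_region_subset: "{v \<in> verts G. w v = 1} \<subseteq> winning_region H"
proof
  fix v assume "v \<in> {v \<in> verts G. w v = 1}"
  then have "v \<in> verts G" "val_strat H f v = 1"
    using val_strat_neutral_ge[of f v] neutral.val_strat_le_1[of f v] by simp_all
  then show "v \<in> winning_region H"
    using f_neutral by (auto simp: winning_region_def winning_strat_def)
qed

lemma winning_closed:
  assumes fw: "fw \<in> strats0 H" and v: "v \<in> verts G" "val_strat H fw v = 1"
    and f1: "f1 \<in> strats1 H" and y: "y \<in> set_pmf (chain H fw f1 v)"
  shows "val_strat H fw y = 1"
proof (rule expectation_ge_bound[OF _ _ _ y])
  show "finite (set_pmf (chain H fw f1 v))"
    using v by (intro closed_set_finite_pmf[OF neutral.closed_verts[OF fw f1]]) simp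
  show "1 \<le> measure_pmf.expectation (chain H fw f1 v) (val_strat H fw)"
    using neutral.val_strat_sub[OF fw f1, of v] v by simp
qed (rule neutral.val_strat_le_1)

lemma chain_neutral [simp]: "chain H = chain G"
  by (intro ext) (simp add: chain_def)

lemma additional_improvementsE:
  assumes "f' \<in> additional_improvements G f"
  obtains fw where "f' \<in> strats0 G" "{v \<in> verts G. w v = 1} \<noteq> winning_region H" "fw \<in> strats0 H"
    "\<And>v. v \<in> winning_region H \<Longrightarrow> val_strat H fw v = 1"
    "\<And>v. v \<in> V0 G \<Longrightarrow> f' v = (if v \<in> winning_region H then fw v else f v)"
proof -
  have ne: "{v \<in> verts G. w v = 1} \<noteq> winning_region H"
    using assms by (auto simp only: additional_improvements_def Let_def split: if_splits)
  then have "f' \<in> {f' \<in> strats0 G.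
      (\<exists>fw\<in>{fw \<in> strats0 H. \<forall>v\<in>winning_region H. winning_strat H v fw}.
        \<forall>v\<in>V0 G \<inter> winning_region H. f' v = fw v) \<and>
      (\<forall>v\<in>V0 G - winning_region H. f' v = f v) \<and>
      (\<forall>v\<in>V0 G \<inter> {v \<in> verts G. w v = 1}. f' v = f v)}"
    using assms unfolding additional_improvements_def Let_def by (simp only: if_False)
  then obtain fw where "f' \<in> strats0 G" "fw \<in> strats0 H"
    and win: "\<forall>v\<in>winning_region H. winning_strat H v fw"
    and eq: "\<forall>v\<in>V0 G \<inter> winning_region H. f' v = fw v" "\<forall>v\<in>V0 G - winning_region H. f' v = f v"
    by blast
  moreover have "val_strat H fw v = 1" if "v \<in> winning_region H" for v
    using win that by (simp add: winning_strat_def)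
  moreover have "f' v = (if v \<in> winning_region H then fw v else f v)" if "v \<in> V0 G" for v
    using eq that by simp
  ultimately show ?thesis
    using that ne by blast
qed

text \<open>In \<open>C\<close> and within the winning region the moves of both players are neutral,
  so the play is one of the subgame, where \<open>fw\<close> wins almost surely and never leaves the
  region.\<close>

lemma winning_region_closed:
  assumes fw: "fw \<in> strats0 H" "\<And>v. v \<in> winning_region H \<Longrightarrow> val_strat H fw v = 1"
    and f': "\<And>v. v \<in> V0 G \<Longrightarrow> v \<in> winning_region H \<Longrightarrow> f' v = fw v"
    and C: "closed_set (chain G f' f1) C" "C \<subseteq> verts G" and f1: "f1 \<in> strats1 G"
    and neutral: "\<And>v. v \<in> C \<Longrightarrow> v \<in> V1 G \<Longrightarrow> w (f1 v) = w v"
    and v: "v \<in> C" "v \<in> winning_region H"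
  shows "val_pair G f' f1 v = 1"
proof -
  obtain g where g: "g \<in> strats1 H"
    using neutral.strats1_nonempty by blast
  \<comment> \<open>\<open>f1\<close> is known to be neutral only on \<open>C\<close>; outside it is
    patched by an arbitrary \<open>g\<close> to obtain a strategy of the subgame.\<close>
  define f1' where "f1' v = (if v \<in> C then f1 v else g v)" for v
  have f1': "f1' \<in> strats1 H"
    using strats1_if[of f1 g "\<lambda>v. v \<in> C"] f1 g neutral
    by (auto simp: f1'_def[abs_def] strats1_neutral)
  let ?D = "C \<inter> winning_region H"
  have eq: "chain G f' f1 x = chain G fw f1' x" if "x \<in> ?D" for x
    using that f' by (simp add: chain_def f1'_def)
  have "closed_set (chain G f' f1) ?D"
    unfolding closed_set_def
  proof (intro conjI ballI subsetI)
    show "finite ?D"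
      using C(1) by (simp add: closed_set_def)
    fix x y assume x: "x \<in> ?D" and y: "y \<in> set_pmf (chain G f' f1 x)"
    have "val_strat H fw y = 1"
      using winning_closed[OF fw(1) _ fw(2) f1', of x y] x y C(2) eq by auto
    moreover have "y \<in> C"
      using x y C(1) by (auto simp: closed_set_def)
    ultimately show "y \<in> ?D"
      using fw(1) C(2) by (auto simp: winning_region_def winning_strat_def)
  qed
  then have "val_pair G f' f1 v = val_pair G fw f1' v"
    by (rule val_pair_cong_closed) (use v eq in auto)
  moreover have "1 \<le> val_pair G fw f1' v"
    using neutral.val_strat_le[OF f1', of fw v] fw(2)[OF v(2)] by simp
  ultimately show ?thesis
    using val_pair_le_1[of G fw f1' v] by simp
qed

text \<open>The new choices are neutral, so \<open>w\<close> remains subharmonic. A closed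
  \<open>C\<close> with constant \<open>w\<close> either avoids the winning region, and then
  \<open>f'\<close> plays \<open>f\<close> on it, or contains a vertex from which \<open>f'\<close>
  wins almost surely, as all moves of Player 1 inside \<open>C\<close> are neutral.\<close>

lemma additional_improvements_le:
  assumes f': "f' \<in> additional_improvements G f" and v: "v \<in> verts G"
  shows "w v \<le> val_strat G f' v"
proof -
  obtain fw where f'0: "f' \<in> strats0 G" and "{v \<in> verts G. w v = 1} \<noteq> winning_region H" and fw: "fw \<in> strats0 H"
    "\<And>v. v \<in> winning_region H \<Longrightarrow> val_strat H fw v = 1"
    and f'_eq: "\<And>v. v \<in> V0 G \<Longrightarrow> f' v = (if v \<in> winning_region H then fw v else f v)"
    using that by (rule additional_improvementsE[OF f'])
  have f'_neutral: "w (f' v) = w v" if "v \<in> V0 G" for v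
    using that fw(1) val_strat_V0[OF f] by (auto simp: f'_eq strats0_neutral)
  show ?thesis
  proof (rule subharmonic_le_val_strat[OF f'0])
    fix f1 v assume f1: "f1 \<in> strats1 G" and v: "v \<in> verts G"
    show "w v \<le> measure_pmf.expectation (chain G f' f1 v) w"
    proof (cases "v \<in> V0 G")
      case True
      then show ?thesis
        by (simp add: chain_def f'_neutral)
    next
      case False
      then have "chain G f' f1 v = chain G f f1 v"
        by (simp add: chain_def)
      then show ?thesis
        using val_strat_sub[OF f f1 v] by simp
    qed
  next
    fix f1 C c
    assume f1: "f1 \<in> strats1 G" and C: "C \<subseteq> verts G" "C \<noteq> {}" "closed_set (chain G f' f1) C"
      and c: "\<And>v. v \<in> C \<Longrightarrow> w v = c"
    obtain x where x: "x \<in> C"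
      using C(2) by blast
    show "\<exists>v\<in>C. c \<le> val_pair G f' f1 v"
    proof (cases "C \<inter> winning_region H = {}")
      case True
      then have "chain G f' f1 y = chain G f f1 y" if "y \<in> C" for y
        using that by (auto simp: chain_def f'_eq)
      then have "val_pair G f' f1 x = val_pair G f f1 x"
        by (rule val_pair_cong_closed[OF C(3) x])
      then have "c \<le> val_pair G f' f1 x"
        using val_strat_le[OF f1, of f x] c[OF x] by simp
      with x show ?thesis
        by blast
    next
      case False
      then obtain y where y: "y \<in> C" "y \<in> winning_region H"
        by blast
      have "w (f1 z) = w z" if z: "z \<in> C" "z \<in> V1 G" for z
      proof -
        have "z \<notin> V0 G"
          using z parity_game by (auto simp: parity_game_def)
        then have "f1 z \<in> C"
          using z C(3) by (auto simp: closed_set_def chain_def)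
        then show ?thesis
          using c z by simp
      qed
      then have "val_pair G f' f1 y = 1"
        using f'_eq by (intro winning_region_closed[OF fw _ C(3,1) f1 _ y]) simp_all
      moreover have "c \<le> 1"
        using c[OF y(1)] val_strat_le_1[of f y] by simp
      ultimately show ?thesis
        using y(1) by (intro bexI[of _ y]) simp_all
    qed
  qed (rule v)
qed

text \<open>If no value changed, a best response to \<open>f'\<close> would be neutral for
  \<open>f\<close>, and \<open>f'\<close> would win almost surely against it on the whole winning
  region of the subgame, also where \<open>w\<close> is below 1.\<close>

lemma additional_improvements_less:
  assumes f': "f' \<in> additional_improvements G f"
  shows "\<exists>v\<in>verts G. w v < val_strat G f' v"
proof (rule ccontr)
  assume "\<not> ?thesis"
  then have eq: "val_strat G f' v = w v" if "v \<in> verts G" for v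
    using additional_improvements_le[OF f' that] that by force
  obtain fw where f'0: "f' \<in> strats0 G" and W: "{v \<in> verts G. w v = 1} \<noteq> winning_region H"
    and fw: "fw \<in> strats0 H"
    "\<And>v. v \<in> winning_region H \<Longrightarrow> val_strat H fw v = 1"
    and f'_eq: "\<And>v. v \<in> V0 G \<Longrightarrow> f' v = (if v \<in> winning_region H then fw v else f v)"
    using that by (rule additional_improvementsE[OF f'])
  obtain x where x: "x \<in> winning_region H" "x \<in> verts G" "w x \<noteq> 1"
    using W winning_region_subset by (auto simp: winning_region_def)
  obtain h where h: "h \<in> strats1 G" "\<And>v. v \<in> verts G \<Longrightarrow> val_strat G f' v = val_pair G f' h v"
    using that by (rule best_response[OF f'0])
  \<comment> \<open>\<open>best_response_neutral\<close> speaks of the subgame with respect to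
    \<open>f'\<close>; as the values of \<open>f'\<close> and \<open>f\<close> coincide, the moves
    are neutral for \<open>f\<close> too.\<close>
  have "w (h z) = w z" if z: "z \<in> V1 G" for z
    using best_response_neutral[OF f'0 h] z strats1_edge[OF h(1) z] edges_verts eq
    unfolding parity_game_loc.strats1_neutral[OF parity_game_loc_axioms] by metis
  then have "val_pair G f' h x = 1"
    using f'_eq x
    by (intro winning_region_closed[OF fw _ closed_verts[OF f'0 h(1)] subset_refl h(1)]) simp_all
  then show False
    using h(2)[OF x(2)] eq[OF x(2)] x(3) by simp
qed

text \<open>If the regions differ, a uniformly optimal strategy of the subgame, followed on its
  winning region only, yields an additional improvement.\<close>

lemma no_additional_improvements:
  assumes none: "additional_improvements G f = {}"
  shows "winning_region H = {v \<in> verts G. w v = 1}"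
proof (rule ccontr)
  assume ne: "\<not> ?thesis"
  obtain h where h: "h \<in> strats0 H"
    "\<And>g v. g \<in> strats0 H \<Longrightarrow> v \<in> verts H \<Longrightarrow> val_strat H g v \<le> val_strat H h v"
    "\<And>v. v \<in> verts H \<Longrightarrow> val_strat H f v = 1 \<Longrightarrow> h v = f v"
    using that by (rule neutral.uniformly_optimal0[OF f_neutral])
  have win: "winning_strat H v h" if "v \<in> winning_region H" for v
  proof -
    obtain g where "g \<in> strats0 H" "val_strat H g v = 1" "v \<in> verts H"
      using \<open>v \<in> winning_region H\<close> unfolding winning_region_def winning_strat_def by blast
    then have "val_strat H h v = 1"
      using h(2)[of g v] neutral.val_strat_le_1[of h v] by simp
    then show ?thesis
      using h(1) by (simp add: winning_strat_def)
  qed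
  define f' where "f' v = (if v \<in> winning_region H then h v else f v)" for v
  have "f' \<in> strats0 G"
    using h(1) f unfolding f'_def[abs_def] by (intro strats0_if) (simp_all add: strats0_neutral)
  \<comment> \<open>\<open>f\<close> has value 1 at \<open>v\<close> in the subgame as well, and
    \<open>h\<close> was obtained so as to keep the choices of \<open>f\<close> there.\<close>
  moreover have "f' v = f v" if v: "v \<in> verts G" "w v = 1" for v
  proof -
    have "val_strat H f v = 1"
      using val_strat_neutral_ge[of f v] neutral.val_strat_le_1[of f v] v by simp
    then show ?thesis
      using h(3)[of v] v by (simp add: f'_def)
  qed
  ultimately have "f' \<in> additional_improvements G f"
    using ne h(1) win by (auto simp: additional_improvements_def Let_def f'_def intro!: bexI[of _ h])
  with none show False
    by simp
qed

lemma optimal_if_no_improvements: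
  assumes none: "improvements G f = {}" "additional_improvements G f = {}"
    and g: "g \<in> strats0 G" and v: "v \<in> verts G"
  shows "val_strat G g v \<le> w v"
proof -
  \<comment> \<open>\<open>g'\<close> is the neutral part of \<open>g\<close>, completed by
    \<open>f\<close>, whose moves are neutral; a best response \<open>h\<close> to it in the subgame
    is then used against \<open>g\<close> itself.\<close>
  define g' where "g' v = (if w (g v) = w v then g v else f v)" for v
  have g': "g' \<in> strats0 H"
    using strats0_if[OF g f, of "\<lambda>v. w (g v) = w v"] val_strat_V0[OF f]
    by (simp add: strats0_neutral g'_def[abs_def])
  obtain h where h: "h \<in> strats1 H" "\<And>v. v \<in> verts H \<Longrightarrow> val_strat H g' v = val_pair H g' h v"
    using that by (rule neutral.best_response[OF g'])
  have hG: "h \<in> strats1 G" and h_neutral: "\<And>v. v \<in> V1 G \<Longrightarrow> w (h v) = w v"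
    using h(1) by (simp_all add: strats1_neutral)
  note cl = closed_verts[OF g hG]
  \<comment> \<open>Under \<open>g\<close> and \<open>h\<close> the expectation of \<open>w\<close>
    cannot rise: no edge of Player 0 is profitable, \<open>h\<close> moves along neutral edges, and
    \<open>w\<close> is harmonic at random vertices.\<close>
  have super: "measure_pmf.expectation (chain G g h x) w \<le> w x" if x: "x \<in> verts G" for x
    using x
  proof (cases rule: verts_cases)
    case 1
    then show ?thesis
      using no_improvements[OF f none(1) 1 strats0_edge[OF g 1]] by (simp add: chain_def)
  next
    case 2
    then show ?thesis
      using h_neutral by (simp add: chain_def)
  next
    case 3
    then show ?thesis
      using val_strat_Vr[OF f] by (simp add: chain_def)
  qed
  have "val_pair G g h v \<le> w v"
  proof (rule ccontr)
    assume "\<not> ?thesis"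
    then have less: "w v < val_pair G g h v"
      by simp
    obtain C c e where C: "C \<subseteq> verts G" "C \<noteq> {}" "closed_set (chain G g h) C" "e < c"
      "\<And>v. v \<in> C \<Longrightarrow> val_pair G g h v = c" "\<And>v. v \<in> C \<Longrightarrow> w v = e"
      by (rule constant_closed_set_of_sub_super[OF cl eq_refl[OF val_pair_harmonic[OF cl]] super v less])
        (assumption | rule that)+
    obtain x where x: "x \<in> C" "x \<in> verts G"
      using C(1,2) by blast
    have "0 \<le> e"
      using C(6)[OF x(1)] val_strat_nonneg[of f x] by simp
    \<comment> \<open>Since \<open>c > e\<close> and \<open>e\<close> is nonnegative, the zero-one
      law leaves only \<open>c = 1\<close>.\<close>
    then have c: "c = 1"
      using val_pair_zero_one[OF C(3,5) x(1)] C(4) by auto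
    have "chain G g h y = chain G g' h y" if y: "y \<in> C" for y
    proof (cases "y \<in> V0 G")
      case True
      then have "g y \<in> C"
        using y C(3) by (auto simp: closed_set_def chain_def)
      then show ?thesis
        using y C(6) True by (simp add: chain_def g'_def)
    next
      case False
      then show ?thesis
        by (simp add: chain_def)
    qed
    then have "val_pair G g h x = val_pair G g' h x"
      by (rule val_pair_cong_closed[OF C(3) x(1)])
    \<comment> \<open>\<open>h\<close> is a best response to \<open>g'\<close> in the subgame, so
      winning almost surely against \<open>h\<close> from \<open>x\<close> already gives
      \<open>g'\<close> value 1 at \<open>x\<close> there.\<close>
    then have "val_strat H g' x = 1"
      using h(2)[of x] x C(5)[OF x(1)] c by simp
    then have "x \<in> winning_region H"
      using g' x by (auto simp: winning_region_def winning_strat_def)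
    then have "w x = 1"
      using no_additional_improvements[OF none(2)] by simp
    then show False
      using C(4) C(6)[OF x(1)] c by simp
  qed
  then show ?thesis
    using val_strat_le[OF hG, of g v] by simp
qed

end

section \<open>Termination and optimality of strategy improvement\<close>

theorem theorem4:
  fixes G :: "'v game"
  assumes "parity_game G"
  shows
    "(\<nexists>F. F 0 \<in> strats0 G \<and>
         (\<forall>i. F (Suc i) \<in> improvements G (F i) \<union> additional_improvements G (F i))) \<and>
     (\<forall>F n. F 0 \<in> strats0 G \<and>
         (\<forall>i<n. F (Suc i) \<in> improvements G (F i) \<union> additional_improvements G (F i)) \<and>
         improvements G (F n) = {} \<and> additional_improvements G (F n) = {} \<longrightarrow>
         F n \<in> strats0 G \<and> (\<forall>v\<in>verts G. val_strat G (F n) v = val G v))"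
proof -
  interpret parity_game_loc G
    by unfold_locales (rule assms)
  have strategy: "strategy0_loc G f" if "f \<in> strats0 G" for f
    by unfold_locales (rule that)
  have in_strats0: "f' \<in> strats0 G" if "f' \<in> improvements G f \<union> additional_improvements G f" for f f'
    using that by (auto simp: improvements_def additional_improvements_def Let_def split: if_splits)
  \<comment> \<open>The potential: each step weakly raises the value at every vertex and strictly at
    some vertex, so the sum grows.\<close>
  define s where "s f = (\<Sum>v\<in>verts G. val_strat G f v)" for f
  have less: "s f < s f'"
    if f: "f \<in> strats0 G" and f': "f' \<in> improvements G f \<union> additional_improvements G f" for f f'
    unfolding s_def
  proof (rule sum_strict_mono_ex1[OF finite_verts])
    show "\<forall>v\<in>verts G. val_strat G f v \<le> val_strat G f' v"
      using f' improvements_le[OF f] strategy0_loc.additional_improvements_le[OF strategy[OF f]] by blast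
    show "\<exists>v\<in>verts G. val_strat G f v < val_strat G f' v"
      using f' improvements_less[OF f] strategy0_loc.additional_improvements_less[OF strategy[OF f]] by blast
  qed
  have "\<not> (F 0 \<in> strats0 G \<and>
      (\<forall>i. F (Suc i) \<in> improvements G (F i) \<union> additional_improvements G (F i)))" for F
  proof
    assume F: "F 0 \<in> strats0 G \<and>
      (\<forall>i. F (Suc i) \<in> improvements G (F i) \<union> additional_improvements G (F i))"
    have strats: "F i \<in> strats0 G" for i
      by (induction i) (use F in_strats0 in blast)+
    \<comment> \<open>A strictly growing potential means that no strategy recurs, but there are only
      finitely many.\<close>
    then have "strict_mono (\<lambda>i. s (F i))"
      using F less by (intro strict_monoI_Suc) blast
    then have "inj F"
      by (metis (mono_tags, lifting) injI strict_mono_eq)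
    then have "infinite (range F)"
      by (rule range_inj_infinite)
    moreover have "range F \<subseteq> strats0 G"
      using strats by blast
    ultimately show False
      using finite_strats0 finite_subset by blast
  qed
  moreover have "F n \<in> strats0 G \<and> (\<forall>v\<in>verts G. val_strat G (F n) v = val G v)"
    if F: "F 0 \<in> strats0 G" "\<forall>i<n. F (Suc i) \<in> improvements G (F i) \<union> additional_improvements G (F i)"
      and none: "improvements G (F n) = {}" "additional_improvements G (F n) = {}" for F n
  proof (intro conjI ballI)
    show Fn: "F n \<in> strats0 G"
      using F in_strats0 by (cases n) blast+
    fix v assume v: "v \<in> verts G"
    have opt: "val_strat G g v \<le> val_strat G (F n) v" if "g \<in> strats0 G" for g
      by (rule strategy0_loc.optimal_if_no_improvements[OF strategy[OF Fn] none that v])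
    have "val G v = (SUP f0\<in>strats0 G. val_strat G f0 v)"
      by (simp add: val_def val_strat_def)
    also have "\<dots> = val_strat G (F n) v"
      using Fn opt by (intro cSup_eq_maximum) auto
    finally show "val_strat G (F n) v = val G v"
      by simp
  qed
  ultimately show ?thesis
    by blast
qed

end
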